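(* Let $\mathbb{T}^1=\mathbb{R}/\mathbb{Z}$, identified with $[0,1)$, with Lebesgue measure, let $\alpha$ be an irrational number of type $\eta$, let $T_\alpha x=x+\alpha \bmod 1$, and let $f:[0,1)\to[0,1]$, $f(x)=x$. Let $J>0$ and fix $x\in\mathbb{T}^1$. With $\beta_c$, $\mathbb{Q}_{n,x}$ and $M_n$ as defined in the context, the following hold. 1. $\beta_c=\frac{3}{2J}$. 2. When $0<\beta<\beta_c$, if $\eta<2$, then under $\mathbb{Q}_{n,x}$, as $n\to\infty$, $$\frac{M_n}{n}\Rightarrow\delta_0\qquad\text{and}\qquad\frac{M_n}{\sqrt n}\Rightarrow\mathcal{N}(0,\sigma^2),\quad\sigma^2=\frac{2}{3-2\beta J}.$$ 3. When $\beta=\beta_c$, if $\eta<4/3$, then under $\mathbb{Q}_{n,x}$, as $n\to\infty$, $$\frac{M_n}{n}\Rightarrow\delta_0\qquad\text{and}\qquad\frac{M_n}{n^{3/4}}\Rightarrow Z,$$ where $Z$ is the probability measure on $\mathbb{R}$ with density $$\frac{\sqrt3\,\Gamma(\frac34)}{\sqrt2\,\pi\,\sqrt[4]{5}}\exp\big(-9s^4/80\big).$$ Here $\Rightarrow$ denotes convergence in distribution.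
   Context: Type of an irrational $\alpha$: $\eta$ is the infimum of all real $\sigma$ for which there is a constant $c=c(\sigma,\alpha)>0$ such that $|h|^\sigma\,\|h\alpha\|\ge c$ for all nonzero integers $h$, where $\|t\|$ is the distance from $t$ to the nearest integer. Gibbs measure: for $\beta>0$ and $n\ge1$, $\mathbb{Q}_{n,x}$ is the probability measure on $\{-1,+1\}^n$ giving $\sigma=(\sigma_1,\dots,\sigma_n)$ a mass proportional to $$\exp\Big(\frac{\beta J}{2n}\Big(\sum_{i=1}^n\sigma_i\Big)^2\Big)\prod_{i=1}^n p_i(\sigma_i),\qquad p_i(1)=f(T_\alpha^ix),\ p_i(-1)=1-f(T_\alpha^ix).$$ When all $f(T_\alpha^ix)\in(0,1)$ this is the measure proportional to $\exp[H_{n,x}(\sigma)]$ with $H_{n,x}(\sigma)=\frac{\beta J}{2n}(\sum_i\sigma_i)^2+\frac12\sum_{i}\log\big(\frac{f(T_\alpha^ix)}{1-f(T_\alpha^ix)}\big)\sigma_i$. The magnetization is $M_n=\sum_{i=1}^n\sigma_i$. Critical inverse temperature: $\beta_c=\sup\{\beta>0: G_\beta(s)\ge0\ \forall s\in\mathbb{R}\}$, where $G_\beta(s)=\frac{\beta J}{2}s^2-\int_0^1\log\big(te^{\beta Js}+(1-t)e^{-\beta Js}\big)\,dt$. *)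

theory Defs
  imports "HOL-Probability.Probability"
begin

definition dist_nearest_int :: "real \<Rightarrow> real" where
  "dist_nearest_int t = \<bar>t - of_int (round t)\<bar>"

text \<open>The infimum is taken in the extended reals, so that the type of a Liouville number,
  for which no exponent is admissible, is \<open>\<infinity>\<close>.\<close>

definition irrational_type :: "real \<Rightarrow> ereal" where
  "irrational_type \<alpha> = Inf (ereal ` {\<sigma>. \<exists>c>0. \<forall>h::int. h \<noteq> 0 \<longrightarrow>
      \<bar>of_int h\<bar> powr \<sigma> * dist_nearest_int (of_int h * \<alpha>) \<ge> c})"

definition rotation :: "real \<Rightarrow> real \<Rightarrow> real" where
  "rotation \<alpha> x = frac (x + \<alpha>)"

definition spin_configs :: "nat \<Rightarrow> (nat \<Rightarrow> real) set" where
  "spin_configs n = (\<Pi>\<^sub>E i\<in>{1..n}. {-1, 1})"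

definition magnetization :: "nat \<Rightarrow> (nat \<Rightarrow> real) \<Rightarrow> real" where
  "magnetization n \<sigma> = (\<Sum>i=1..n. \<sigma> i)"

definition spin_prob ::
  "(real \<Rightarrow> real) \<Rightarrow> real \<Rightarrow> real \<Rightarrow> nat \<Rightarrow> real \<Rightarrow> real" where
  "spin_prob f \<alpha> x i s =
     (if s = 1 then f ((rotation \<alpha> ^^ i) x) else 1 - f ((rotation \<alpha> ^^ i) x))"

definition gibbs_weight ::
  "(real \<Rightarrow> real) \<Rightarrow> real \<Rightarrow> real \<Rightarrow> real \<Rightarrow> nat \<Rightarrow> real \<Rightarrow> (nat \<Rightarrow> real) \<Rightarrow> real" where
  "gibbs_weight f \<alpha> J \<beta> n x \<sigma> =
     exp (\<beta> * J / (2 * real n) * (\<Sum>i=1..n. \<sigma> i)\<^sup>2) * (\<Prod>i=1..n. spin_prob f \<alpha> x i (\<sigma> i))"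

definition gibbs_measure ::
  "(real \<Rightarrow> real) \<Rightarrow> real \<Rightarrow> real \<Rightarrow> real \<Rightarrow> nat \<Rightarrow> real \<Rightarrow> (nat \<Rightarrow> real) measure" where
  "gibbs_measure f \<alpha> J \<beta> n x =
     point_measure (spin_configs n)
       (\<lambda>\<sigma>. ennreal (gibbs_weight f \<alpha> J \<beta> n x \<sigma> /
              (\<Sum>\<tau>\<in>spin_configs n. gibbs_weight f \<alpha> J \<beta> n x \<tau>)))"

definition G_fun :: "real \<Rightarrow> real \<Rightarrow> real \<Rightarrow> real" where
  "G_fun J \<beta> s = \<beta> * J / 2 * s\<^sup>2 -
     (LBINT t:{0..1}. ln (t * exp (\<beta> * J * s) + (1 - t) * exp (- (\<beta> * J * s))))"

definition critical_beta :: "real \<Rightarrow> real" where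
  "critical_beta J = Sup {\<beta>. \<beta> > 0 \<and> (\<forall>s. G_fun J \<beta> s \<ge> 0)}"

definition quartic_density :: "real \<Rightarrow> real" where
  "quartic_density s = sqrt 3 * Gamma (3/4) / (sqrt 2 * pi * root 4 5) * exp (- 9 * s ^ 4 / 80)"

end

theory Submission
  imports Defs
begin

text \<open>By the Hubbard-Stratonovich transform, a suitably scaled \<open>M\<^sub>n\<close> plus an independent Gaussian has density
  proportional to \<open>exp (- n G\<^sub>n)\<close>, where \<open>G\<^sub>n\<close> is the function \<open>G\<^sub>\<beta>\<close> with the integral over \<open>t\<close> replaced by
  the average along the orbit of \<open>x\<close>. The integrand is monotone in \<open>t\<close> with total variation \<open>2 \<beta> J \<bar>s\<bar>\<close>, and a
  Denjoy-Koksma argument bounds the error \<open>n (G\<^sub>n s - G\<^sub>\<beta> s)\<close> by a multiple of \<open>\<bar>s\<bar> n powr (1 - 1/\<tau>)\<close> for every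
  \<open>\<tau> > max 1 \<eta>\<close>. At the scale \<open>s = u / n powr \<gamma>\<close> the error vanishes when \<open>1 - 1/\<tau> < \<gamma>\<close>; here \<open>\<gamma> = 1/2\<close>
  below \<open>\<beta>\<^sub>c\<close> and \<open>\<gamma> = 1/4\<close> at \<open>\<beta>\<^sub>c\<close>. The integral in \<open>G\<^sub>\<beta>\<close> equals \<open>c coth c - 1\<close> with \<open>c = \<beta> J s\<close>, and
  rational bounds for it give both the limit of \<open>n G\<^sub>\<beta> (u / n powr \<gamma>)\<close> and the domination needed to pass to the
  limit in the characteristic functions, from which the Gaussian factor is divided out.\<close>

section \<open>Discrepancy of irrational rotations for monotone functions\<close>

text \<open>On each cell of length \<open>1/q\<close> a monotone \<open>g\<close> lies between its
  two end values, and the gaps between end values telescope. Partial sums up to \<open>m\<close>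
  make the induction possible; the use is at \<open>m = q\<close>.\<close>

lemma Riemann_sum_mono_bounds:
  fixes g :: "real \<Rightarrow> real"
  assumes mono: "mono_on {0..1} g" and int: "g integrable_on {0..1}"
    and q: "q > 0" and m: "m \<le> q"
  shows "(\<Sum>r<m. g (real r / real q)) \<le> real q * integral {0..real m / real q} g"
    and "real q * integral {0..real m / real q} g
           \<le> (\<Sum>r<m. g (real r / real q)) + (g (real m / real q) - g 0)"
proof -
  have "(\<Sum>r<m. g (real r / real q)) \<le> real q * integral {0..real m / real q} g \<and>
        real q * integral {0..real m / real q} g
           \<le> (\<Sum>r<m. g (real r / real q)) + (g (real m / real q) - g 0)"
    using m
  proof (induction m)
    case 0
    then show ?case by simp
  next
    case (Suc m)
    let ?a = "real m / real q" and ?b = "real (Suc m) / real q"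
    have ab: "0 \<le> ?a" "?a \<le> ?b" "?b \<le> 1"
      using Suc.prems q by (auto simp: divide_simps)
    have int': "g integrable_on {?a..?b}" "g integrable_on {0..?b}"
      by (rule integrable_subinterval_real[OF int]; use ab in auto)+
    have comb: "integral {0..?b} g = integral {0..?a} g + integral {?a..?b} g"
      using Henstock_Kurzweil_Integration.integral_combine[OF ab(1,2) int'(2)] by simp
    have "integral {?a..?b} (\<lambda>_. g ?a) \<le> integral {?a..?b} g"
      by (rule integral_le) (use int' ab in \<open>auto intro!: mono_onD[OF mono] intro: order_trans[OF ab(1)] simp del: of_nat_Suc\<close>)
    moreover have "integral {?a..?b} g \<le> integral {?a..?b} (\<lambda>_. g ?b)"
      by (rule integral_le) (use int' ab in \<open>auto intro!: mono_onD[OF mono] intro: order_trans[OF ab(1)] simp del: of_nat_Suc\<close>)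
    moreover have "?b - ?a = 1 / real q" by (simp add: add_divide_distrib)
    ultimately have "g ?a \<le> real q * integral {?a..?b} g" "real q * integral {?a..?b} g \<le> g ?b"
      using ab q by (auto simp: field_simps)
    with Suc.IH Suc.prems show ?case
      unfolding comb by (simp add: distrib_left)
  qed
  then show "(\<Sum>r<m. g (real r / real q)) \<le> real q * integral {0..real m / real q} g"
    and "real q * integral {0..real m / real q} g
           \<le> (\<Sum>r<m. g (real r / real q)) + (g (real m / real q) - g 0)"
    by auto
qed

lemma sum_lessThan_telescope_two:
  fixes a :: "nat \<Rightarrow> real"
  shows "(\<Sum>r<m. a (r + 2) - a r) = a (m + 1) + a m - a 1 - a 0"
  by (induction m) (auto simp: numeral_2_eq_2)

text \<open>Multiplication by \<open>p\<close> is injective modulo \<open>q\<close> because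
  \<open>p\<close> is a unit there. Thus the rational rotation by \<open>p/q\<close> visits each of
  the \<open>q\<close> cells exactly once.\<close>

lemma bij_betw_mod_shift:
  fixes p k :: int
  assumes "coprime p (int q)" "q > 0"
  shows "bij_betw (\<lambda>i. nat ((k + int i * p) mod int q)) {..<q} {..<q}"
proof -
  have "inj_on (\<lambda>i. nat ((k + int i * p) mod int q)) {..<q}"
  proof (rule inj_onI)
    fix i j assume ij: "i \<in> {..<q}" "j \<in> {..<q}"
      and "nat ((k + int i * p) mod int q) = nat ((k + int j * p) mod int q)"
    then have "(k + int i * p) mod int q = (k + int j * p) mod int q"
      using assms(2) by (metis eq_nat_nat_iff of_nat_0_less_iff pos_mod_sign)
    then have "int q dvd (k + int i * p) - (k + int j * p)"
      by (simp add: mod_eq_dvd_iff)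
    then have "int q dvd (int i - int j) * p" by (simp add: algebra_simps)
    with assms(1) have "int q dvd int i - int j"
      by (simp add: coprime_commute coprime_dvd_mult_left_iff)
    then have "int i mod int q = int j mod int q" by (simp add: mod_eq_dvd_iff)
    with ij show "i = j" by simp
  qed
  moreover have "(\<lambda>i. nat ((k + int i * p) mod int q)) ` {..<q} \<subseteq> {..<q}"
    using assms(2) by (auto simp: nat_less_iff)
  ultimately show ?thesis
    by (simp add: bij_betw_def endo_inj_surj)
qed

text \<open>The \<open>q\<close> orbit points lie, up to one neighbouring cell, in the \<open>q\<close> cells \<open>[r/q, (r+1)/q)\<close>, one
  per cell; monotonicity makes the resulting errors telescope. Only the two cells next to the
  discontinuity of \<^term>\<open>frac\<close> have to be treated separately.\<close>

lemma Denjoy_Koksma_mono: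
  fixes g :: "real \<Rightarrow> real" and p :: int
  assumes mono: "mono_on {0..1} g" and int: "g integrable_on {0..1}"
    and cop: "coprime p (int q)" and q: "q > 0"
    and approx: "\<bar>real q * \<alpha> - of_int p\<bar> \<le> 1 / real q"
  shows "\<bar>(\<Sum>i<q. g (frac (y + real i * \<alpha>))) - real q * integral {0..1} g\<bar> \<le> 6 * (g 1 - g 0)"
proof -
  define V where "V = g 1 - g 0"
  \<comment> \<open>Truncating the index at \<open>q\<close> lets \<open>a (r + 2)\<close> stand for
    \<open>g 1\<close> when it runs past the last cell.\<close>
  define a where "a r = g (real (min r q) / real q)" for r
  have a_mono: "a r \<le> a s" if "r \<le> s" for r s
    unfolding a_def using that q by (auto intro!: mono_onD[OF mono] simp: divide_simps min_def)
  have a0: "a 0 = g 0" unfolding a_def by simp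
  have aq: "a r = g 1" if "r \<ge> q" for r using that q unfolding a_def by (simp add: min_def)
  have V0: "V \<ge> 0" unfolding V_def using mono_onD[OF mono, of 0 1] by simp
  \<comment> \<open>The error from neighbouring cells plus, for the first and last cell, the full
    variation \<open>V\<close>: there the perturbed point may wrap around. At \<open>r = 0\<close>
    natural subtraction makes \<open>a (r - 1)\<close> equal to \<open>a 0\<close>.\<close>
  define d where "d r = a (r + 2) - a (r - 1) + (if r = 0 \<or> r = q - 1 then V else 0)" for r
  have g_le: "g 0 \<le> g z" "g z \<le> g 1" if "0 \<le> z" "z \<le> 1" for z
    using that by (auto intro!: mono_onD[OF mono])
  define k where "k = \<lfloor>real q * y\<rfloor>"
  \<comment> \<open>Index of the cell containing \<open>y + i p/q\<close> modulo 1. Replacing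
    \<open>p/q\<close> by \<alpha> moves \<open>q\<close> times the point by less than 1, since
    \<open>i < q\<close>; as \<open>q y\<close> exceeds \<open>k\<close> by less than 1, the scaled
    point lands strictly between \<open>r - 1\<close> and \<open>r + 2\<close>.\<close>
  define \<rho> where "\<rho> i = nat ((k + int i * p) mod int q)" for i
  have bij: "bij_betw \<rho> {..<q} {..<q}"
    unfolding \<rho>_def by (rule bij_betw_mod_shift[OF cop q])
  have point: "\<bar>g (frac (y + real i * \<alpha>)) - a (\<rho> i)\<bar> \<le> d (\<rho> i)" if i: "i < q" for i
  proof -
    define r where "r = \<rho> i"
    have r: "r < q" unfolding r_def using bij i by (auto simp: bij_betw_def)
    have f01: "0 \<le> frac (y + real i * \<alpha>)" "frac (y + real i * \<alpha>) \<le> 1"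
      by (auto simp: less_imp_le frac_lt_1)
    show ?thesis
    proof (cases "r = 0 \<or> r = q - 1")
      case True
      have "a r \<in> {g 0..g 1}"
        using g_le unfolding a_def using q by auto
      then have "\<bar>g (frac (y + real i * \<alpha>)) - a r\<bar> \<le> V"
        using g_le[OF f01] unfolding V_def by auto
      also have "\<dots> \<le> d r" unfolding d_def using True a_mono[of "r-1" "r+2"] by auto
      finally show ?thesis by (simp add: r_def)
    next
      case False
      then have r1: "1 \<le> r" "r + 2 \<le> q" using r by auto
      define e where "e = (k + int i * p) div int q"
      have ke: "k + int i * p = int q * e + int r"
        unfolding e_def r_def \<rho>_def using q by (simp add: algebra_simps)
      define w where "w = y + real i * \<alpha> - of_int e"
      have qk: "of_int k \<le> real q * y" "real q * y < of_int k + 1"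
        unfolding k_def by linarith+
      have "real i * \<bar>real q * \<alpha> - of_int p\<bar> \<le> real i * (1 / real q)"
        by (rule mult_left_mono[OF approx]) simp
      also have "\<dots> < 1" using i q by (simp add: field_simps)
      finally have "\<bar>real i * (real q * \<alpha> - of_int p)\<bar> < 1" by (simp add: abs_mult)
      moreover have "real q * w = (real q * y - of_int k) + real i * (real q * \<alpha> - of_int p) + real r"
      proof -
        have "(of_int k::real) + real i * of_int p = real q * of_int e + real r"
          using arg_cong[OF ke, of "of_int :: int \<Rightarrow> real"] by simp
        then show ?thesis unfolding w_def by (simp add: algebra_simps)
      qed
      ultimately have qw: "real r - 1 < real q * w" "real q * w < real r + 2"
        using qk by linarith+
      have w: "(real r - 1) / real q < w" "w < (real r + 2) / real q"
        using qw q by (simp_all add: field_simps)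
      have w01: "0 \<le> (real r - 1) / real q" "(real r + 2) / real q \<le> 1"
        using r1 q by (simp_all add: field_simps)
      have w01': "0 \<le> w" "w \<le> 1" using w w01 by linarith+
      have "frac (y + real i * \<alpha>) = w"
        using w w01 unfolding w_def by (subst frac_unique_iff) auto
      moreover have "a (r - 1) \<le> g w"
        unfolding a_def using w w01 w01' r1
        by (auto intro!: mono_onD[OF mono] simp: of_nat_diff min_def)
      moreover have "g w \<le> a (r + 2)"
        unfolding a_def using w w01 w01' r1
        by (auto intro!: mono_onD[OF mono] simp: of_nat_diff min_def add.commute)
      moreover have "a (r - 1) \<le> a r" "a r \<le> a (r + 2)" by (auto intro!: a_mono)
      ultimately show ?thesis unfolding d_def r_def[symmetric] using False by auto
    qed
  qed
  have "\<bar>(\<Sum>i<q. g (frac (y + real i * \<alpha>))) - (\<Sum>i<q. a (\<rho> i))\<bar> \<le> (\<Sum>i<q. d (\<rho> i))"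
    unfolding sum_subtractf[symmetric]
    by (rule order_trans[OF sum_abs]) (intro sum_mono point, simp)
  also have "(\<Sum>i<q. a (\<rho> i)) = (\<Sum>r<q. a r)" by (rule sum.reindex_bij_betw[OF bij])
  also have "(\<Sum>i<q. d (\<rho> i)) = (\<Sum>r<q. d r)" by (rule sum.reindex_bij_betw[OF bij])
  also have "(\<Sum>r<q. d r) = (\<Sum>r<q. a (r + 2) - a r) + (\<Sum>r<q. a r - a (r - 1))
      + (\<Sum>r<q. if r = 0 \<or> r = q - 1 then V else 0)"
    unfolding d_def by (simp add: sum.distrib sum_subtractf)
  also have "(\<Sum>r<q. a (r + 2) - a r) = a (q + 1) + a q - a 1 - a 0"
    by (rule sum_lessThan_telescope_two)
  also have "(\<Sum>r<q. a r - a (r - 1)) = a (q - 1) - a 0"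
  proof -
    obtain m where m: "q = Suc m" using q by (cases q) auto
    show ?thesis unfolding m by (subst sum.lessThan_Suc_shift) (simp add: sum_lessThan_telescope)
  qed
  finally have A': "\<bar>(\<Sum>i<q. g (frac (y + real i * \<alpha>))) - (\<Sum>r<q. a r)\<bar>
      \<le> a (q + 1) + a q - a 1 - a 0 + (a (q - 1) - a 0) + (\<Sum>r<q. if r = 0 \<or> r = q - 1 then V else 0)" .
  have "(\<Sum>r<q. if r = 0 \<or> r = q - 1 then V else 0) \<le> 2 * V"
  proof -
    have "(\<Sum>r<q. if r = 0 \<or> r = q - 1 then V else 0) = (\<Sum>r\<in>{0, q - 1}. V)"
      using q by (intro sum.mono_neutral_cong_right) auto
    also have "\<dots> = real (card {0, q - 1}) * V" by simp
    also have "\<dots> \<le> 2 * V" using V0 by (intro mult_right_mono) (auto simp: card_insert_if)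
    finally show ?thesis .
  qed
  \<comment> \<open>The telescoped sums contribute at most \<open>2 * V\<close> and
    \<open>V\<close>, the two exceptional cells \<open>2 * V\<close>. Comparing the Riemann sum with
    the integral costs one more \<open>V\<close>, which gives the factor 6.\<close>
  with A' have A: "\<bar>(\<Sum>i<q. g (frac (y + real i * \<alpha>))) - (\<Sum>r<q. a r)\<bar> \<le> 5 * V"
    using aq[of "q+1", simplified] aq[of q, simplified] a0 a_mono[of 0 1, simplified] a_mono[of "q-1" q, simplified]
    unfolding V_def by simp
  have "(\<Sum>r<q. a r) = (\<Sum>r<q. g (real r / real q))"
    unfolding a_def by (intro sum.cong) (auto simp: min_def)
  with Riemann_sum_mono_bounds[OF mono int q order_refl] q
  have "\<bar>(\<Sum>r<q. a r) - real q * integral {0..1} g\<bar> \<le> V"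
    unfolding V_def by simp
  moreover have "\<bar>u - w\<bar> \<le> 6 * V" if "\<bar>u - v\<bar> \<le> 5 * V" "\<bar>v - w\<bar> \<le> V" for u v w
    using that by linarith
  ultimately show ?thesis using A unfolding V_def by blast
qed

section \<open>Orbit sums of arbitrary length under a Diophantine condition\<close>

lemma dist_nearest_int_le: "dist_nearest_int t \<le> \<bar>t - of_int m\<bar>"
  using round_diff_minimal[of t m] by (simp add: dist_nearest_int_def abs_minus_commute)

lemma orbit_sum_split:
  fixes g :: "real \<Rightarrow> real"
  shows "(\<Sum>i<m + n. g (frac (y + real i * \<alpha>)))
    = (\<Sum>i<m. g (frac (y + real i * \<alpha>))) + (\<Sum>i<n. g (frac (y + real m * \<alpha> + real i * \<alpha>)))"
  by (induction n) (simp_all add: algebra_simps)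

text \<open>Dirichlet's theorem provides a Denjoy-Koksma denominator \<open>q \<le> n\<close>, which the Diophantine condition
  bounds below by a multiple of \<open>n powr (1/s)\<close>. Removing all complete blocks of length \<open>q\<close> leaves fewer
  than \<open>n/2\<close> points, so the block errors form a geometric series.\<close>

lemma orbit_sum_discrepancy:
  fixes \<alpha> c s :: real
  assumes c: "c > 0" and s: "s > 1"
    and dioph: "\<And>h::int. h \<noteq> 0 \<Longrightarrow> \<bar>of_int h\<bar> powr s * dist_nearest_int (of_int h * \<alpha>) \<ge> c"
  obtains K where "K \<ge> 0" and
    "\<And>(g::real \<Rightarrow> real) y n. mono_on {0..1} g \<Longrightarrow> g integrable_on {0..1} \<Longrightarrow>
       \<bar>(\<Sum>i<n. g (frac (y + real i * \<alpha>))) - real n * integral {0..1} g\<bar>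
         \<le> K * (g 1 - g 0) * real n powr (1 - 1/s)"
proof -
  define \<delta> where "\<delta> = 1 - 1/s"
  have \<delta>: "\<delta> > 0" unfolding \<delta>_def using s by simp
  \<comment> \<open>At most \<open>c powr (-1/s) * n powr \<delta>\<close> blocks cost
    \<open>6 * V\<close> each, which gives \<open>B\<close>; a remainder of length at most
    \<open>n/2\<close> brings in the factor \<open>\<theta>\<close>. \<open>K\<close> solves
    \<open>K = B + K * \<theta>\<close> and is the sum of the geometric series.\<close>
  define B where "B = 6 * c powr (-1/s)"
  define \<theta> where "\<theta> = 2 powr (-\<delta>)"
  have \<theta>: "\<theta> < 1" unfolding \<theta>_def using \<delta> by (simp add: powr_less_one)
  define K where "K = B / (1 - \<theta>)"
  have B0: "B \<ge> 0" unfolding B_def by simp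
  have K0: "K \<ge> 0" unfolding K_def using B0 \<theta> by simp
  have KB: "B + K * \<theta> = K" unfolding K_def using \<theta> by (simp add: field_simps)
  have main: "\<bar>(\<Sum>i<n. g (frac (y + real i * \<alpha>))) - real n * integral {0..1} g\<bar>
         \<le> K * (g 1 - g 0) * real n powr \<delta>"
    if mono: "mono_on {0..1} g" and int: "g integrable_on {0..1}" for g :: "real \<Rightarrow> real" and y n
  proof (induction n arbitrary: y rule: less_induct)
    case (less n)
    define I where "I = integral {0..1} g"
    define V where "V = g 1 - g 0"
    have V0: "V \<ge> 0" unfolding V_def using mono_onD[OF mono, of 0 1] by simp
    show ?case
    proof (cases "n = 0")
      case True
      then show ?thesis by simp
    next
      case False
      then obtain h k where hk: "coprime h k" "0 < k" "k \<le> int n"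
          "\<bar>of_int k * \<alpha> - of_int h\<bar> < 1 / real n"
        using Dirichlet_approx_coprime[of n \<alpha>] by auto
      define q where "q = nat k"
      have q: "q > 0" "q \<le> n" "int q = k" unfolding q_def using hk by auto
      then have rq: "(of_int k :: real) = real q" by (metis of_int_of_nat_eq)
      have appr: "\<bar>real q * \<alpha> - of_int h\<bar> < 1 / real n" using hk(4) rq by simp
      also have "1 / real n \<le> 1 / real q" using q by (simp add: field_simps)
      finally have appr': "\<bar>real q * \<alpha> - of_int h\<bar> \<le> 1 / real q" by simp
      have block: "\<bar>(\<Sum>i<q. g (frac (z + real i * \<alpha>))) - real q * I\<bar> \<le> 6 * V" for z
        unfolding I_def V_def
        by (rule Denjoy_Koksma_mono[OF mono int _ q(1) appr']) (use hk q in auto)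
      have blocks: "\<bar>(\<Sum>i<b*q. g (frac (z + real i * \<alpha>))) - real (b*q) * I\<bar> \<le> real b * (6 * V)" for b z
      proof (induction b arbitrary: z)
        case (Suc b)
        have "(\<Sum>i<Suc b*q. g (frac (z + real i * \<alpha>))) = (\<Sum>i<q. g (frac (z + real i * \<alpha>)))
            + (\<Sum>i<b*q. g (frac (z + real q * \<alpha> + real i * \<alpha>)))"
          using orbit_sum_split[where m = q and n = "b*q"] by simp
        moreover have "real (Suc b * q) * I = real q * I + real (b * q) * I"
          by (simp add: algebra_simps)
        moreover have "real (Suc b) * (6 * V) = 6 * V + real b * (6 * V)"
          by (simp add: algebra_simps)
        ultimately show ?case using block[of z] Suc.IH[of "z + real q * \<alpha>"] by linarith
      qed simp
      define b where "b = n div q"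
      define r where "r = n mod q"
      have n: "n = b * q + r" unfolding b_def r_def by simp
      have rq': "r < q" unfolding r_def using q by simp
      have "b \<ge> 1" unfolding b_def using q by (simp add: div_greater_zero_iff Suc_leI)
      then have "b * q \<ge> q" by simp
      with n rq' have rn: "2 * r \<le> n" "r < n" by linarith+
      have IH: "\<bar>(\<Sum>i<r. g (frac (z + real i * \<alpha>))) - real r * I\<bar> \<le> K * V * real r powr \<delta>" for z
        using less.IH[OF rn(2)] unfolding I_def V_def .
      have "c \<le> real q powr s * dist_nearest_int (real q * \<alpha>)"
        using dioph[of k] hk(2) rq by simp
      also have "\<dots> \<le> real q powr s * (1 / real n)"
        using dist_nearest_int_le[of "real q * \<alpha>" h] appr by (intro mult_left_mono) auto
      finally have "c * real n \<le> real q powr s" using False by (simp add: field_simps)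
      then have "(c * real n) powr (1/s) \<le> (real q powr s) powr (1/s)"
        using c s by (intro powr_mono2) auto
      then have ql: "(c * real n) powr (1/s) \<le> real q"
        using s q by (simp add: powr_powr)
      have pos: "(c * real n) powr (1/s) > 0" using c False by simp
      have "real b * real q \<le> real n" using n by (metis le_add1 of_nat_mono of_nat_mult)
      then have "real b \<le> real n / real q" using q by (simp add: field_simps)
      also have "\<dots> \<le> real n / (c * real n) powr (1/s)"
        using ql pos q by (intro divide_left_mono mult_pos_pos) auto
      also have "\<dots> = c powr (-1/s) * real n powr \<delta>"
      proof -
        have "real n powr \<delta> = real n / real n powr (1/s)"
          unfolding \<delta>_def using False by (subst powr_diff) simp
        then show ?thesis using c False by (simp add: powr_mult powr_minus divide_simps)
      qed
      finally have "6 * real b \<le> B * real n powr \<delta>" unfolding B_def by simp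
      then have "6 * real b * V \<le> B * real n powr \<delta> * V" using V0 by (rule mult_right_mono)
      then have b: "real b * (6 * V) \<le> B * V * real n powr \<delta>" by (simp add: mult_ac)
      have "real r powr \<delta> \<le> (real n / 2) powr \<delta>"
        using rn \<delta> by (intro powr_mono2) auto
      also have "\<dots> = \<theta> * real n powr \<delta>"
        unfolding \<theta>_def by (simp add: powr_divide powr_minus field_simps)
      finally have "K * V * real r powr \<delta> \<le> K * V * (\<theta> * real n powr \<delta>)"
        using K0 V0 by (intro mult_left_mono) auto
      with b have "real b * (6 * V) + K * V * real r powr \<delta> \<le> (B + K * \<theta>) * V * real n powr \<delta>"
        by (simp add: algebra_simps)
      then have fin: "real b * (6 * V) + K * V * real r powr \<delta> \<le> K * V * real n powr \<delta>"
        unfolding KB .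
      have "(\<Sum>i<n. g (frac (y + real i * \<alpha>))) = (\<Sum>i<b*q. g (frac (y + real i * \<alpha>)))
            + (\<Sum>i<r. g (frac (y + real (b*q) * \<alpha> + real i * \<alpha>)))"
        unfolding n by (rule orbit_sum_split)
      moreover have "real n * I = real (b * q) * I + real r * I"
        unfolding n by (simp add: algebra_simps)
      ultimately show ?thesis
        using fin blocks[where b = b and z = y] IH[of "y + real (b*q) * \<alpha>"] unfolding V_def[symmetric] I_def[symmetric]
        by linarith
    qed
  qed
  from that[OF K0 main[unfolded \<delta>_def]] show ?thesis by blast
qed

section \<open>The mean free energy and the critical temperature\<close>

text \<open>Logarithm of the expectation of \<open>exp (c * \<sigma>)\<close> for a single spin
  \<sigma> that is 1 with probability \<open>t\<close> and -1 otherwise.\<close>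

definition spin_log_mgf :: "real \<Rightarrow> real \<Rightarrow> real" where
  "spin_log_mgf c t = ln (t * exp c + (1 - t) * exp (- c))"

lemma spin_mgf_pos:
  assumes "0 \<le> t" "t \<le> 1"
  shows "t * exp c + (1 - t) * exp (- c :: real) > 0"
proof (cases "t = 0")
  case False
  with assms have "t * exp c > 0" by simp
  moreover have "(1 - t) * exp (- c) \<ge> 0" using assms by simp
  ultimately show ?thesis by linarith
qed simp

lemma continuous_on_spin_log_mgf: "continuous_on {0..1} (spin_log_mgf c)"
  unfolding spin_log_mgf_def using spin_mgf_pos[of _ c]
  by (intro continuous_intros) (auto simp: less_imp_neq[symmetric])

lemma spin_log_mgf_integrable: "spin_log_mgf c integrable_on {0..1}"
  by (intro integrable_continuous_interval continuous_on_spin_log_mgf)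

lemma spin_log_mgf_0_1 [simp]: "spin_log_mgf c 0 = - c" "spin_log_mgf c 1 = c"
  by (simp_all add: spin_log_mgf_def)

lemma mono_on_spin_log_mgf:
  assumes "c \<ge> 0"
  shows "mono_on {0..1} (spin_log_mgf c)"
proof (rule mono_onI)
  fix s t :: real assume st: "s \<in> {0..1}" "t \<in> {0..1}" "s \<le> t"
  have "exp (-c) \<le> exp c" using assms by simp
  then have "s * (exp c - exp (-c)) \<le> t * (exp c - exp (-c))"
    using st by (intro mult_right_mono) auto
  then have "s * exp c + (1 - s) * exp (- c) \<le> t * exp c + (1 - t) * exp (- c)"
    by (simp add: algebra_simps)
  then show "spin_log_mgf c s \<le> spin_log_mgf c t"
    unfolding spin_log_mgf_def using spin_mgf_pos[of s c] st by (subst ln_le_cancel_iff) auto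
qed

text \<open>Exchanging the two spin values turns \<open>(c, t)\<close> into
  \<open>(-c, 1 - t)\<close>, which reduces the claim to nonnegative \<open>c\<close>. The negated
  function fits the discrepancy bound, which is stated for increasing functions.\<close>

lemma mono_on_spin_log_mgf_neg:
  assumes "c \<le> 0"
  shows "mono_on {0..1} (\<lambda>t. - spin_log_mgf c t)"
proof (rule mono_onI)
  fix s t :: real assume st: "s \<in> {0..1}" "t \<in> {0..1}" "s \<le> t"
  have "spin_log_mgf (-c) (1 - t) \<le> spin_log_mgf (-c) (1 - s)"
    using assms st by (intro mono_onD[OF mono_on_spin_log_mgf]) auto
  then show "- spin_log_mgf c s \<le> - spin_log_mgf c t"
    using spin_mgf_pos[of s c] spin_mgf_pos[of t c] st by (simp add: spin_log_mgf_def add.commute)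
qed

section \<open>Closed form and rational bounds of the averaged single-spin free energy\<close>

definition mean_log_mgf :: "real \<Rightarrow> real" where
  "mean_log_mgf c = integral {0..1} (spin_log_mgf c)"

lemma mean_log_mgf_0 [simp]: "mean_log_mgf 0 = 0"
  unfolding mean_log_mgf_def spin_log_mgf_def by simp

lemma G_fun_eq: "G_fun J \<beta> s = \<beta> * J / 2 * s\<^sup>2 - mean_log_mgf (\<beta> * J * s)"
proof -
  have "set_integrable lborel {0..1} (spin_log_mgf c)" for c
    by (intro borel_integrable_atLeastAtMost' continuous_on_spin_log_mgf)
  from set_borel_integral_eq_integral(2)[OF this]
  show ?thesis unfolding G_fun_def mean_log_mgf_def by (simp add: spin_log_mgf_def)
qed

text \<open>The argument \<open>w\<close> of the logarithm is affine in \<open>t\<close> with slope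
  \<open>D = 2 sinh c\<close>, so \<open>(w ln w - w) / D\<close> is an antiderivative. Multiplying
  \<open>c coth c - 1\<close> by \<open>sinh c\<close> keeps the formula valid at
  \<open>c = 0\<close>.\<close>

lemma mean_log_mgf_sinh: "mean_log_mgf c * sinh c = c * cosh c - sinh c"
proof (cases "c = 0")
  case False
  define D where "D = exp c - exp (- c)"
  have D: "D \<noteq> 0" unfolding D_def using False by simp
  define w where "w t = t * exp c + (1 - t) * exp (- c)" for t
  define F where "F t = (w t * ln (w t) - w t) / D" for t
  have w: "w t > 0" if "t \<in> {0..1}" for t
    unfolding w_def using that spin_mgf_pos[of t c] by auto
  have wd: "(w has_real_derivative D) (at t)" for t
    unfolding w_def D_def by (auto intro!: derivative_eq_intros)
  have "(F has_real_derivative spin_log_mgf c t) (at t)" if "t \<in> {0..1}" for t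
  proof -
    have "(F has_real_derivative ((D * ln (w t) + w t * (D / w t)) - D) / D) (at t)"
      unfolding F_def using w[OF that] D
      by (auto intro!: derivative_eq_intros wd)
    moreover have "w t * (D / w t) = D" using w[OF that] by simp
    then have "((D * ln (w t) + w t * (D / w t)) - D) / D = spin_log_mgf c t"
      using D by (simp add: spin_log_mgf_def w_def)
    ultimately show ?thesis by simp
  qed
  then have "(spin_log_mgf c has_integral (F 1 - F 0)) {0..1}"
    by (intro fundamental_theorem_of_calculus)
       (auto simp: has_real_derivative_iff_has_vector_derivative[symmetric] intro: has_field_derivative_at_within)
  then have "mean_log_mgf c = F 1 - F 0"
    unfolding mean_log_mgf_def by (rule integral_unique)
  also have "\<dots> = (c * exp c - exp c - (- c * exp (-c) - exp (-c))) / D"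
    by (simp add: F_def w_def diff_divide_distrib add_divide_distrib mult.commute)
  finally have "mean_log_mgf c * D = c * exp c - exp c - (- c * exp (-c) - exp (-c))"
    using D by simp
  then show ?thesis
    by (simp add: sinh_field_def cosh_field_def D_def field_simps)
qed simp

text \<open>The functions \<open>y\<^sub>0 = sinh\<close>, \<open>y\<^sub>1\<close>, \<open>y\<^sub>2\<close>, ... below satisfy \<open>y\<^sub>k\<^sub>+\<^sub>1' = c y\<^sub>k\<close> and \<open>y\<^sub>k\<^sub>+\<^sub>1 0 = 0\<close>
  (they are modified spherical Bessel functions up to powers of \<open>c\<close>); their positivity yields the convergents of the continued
  fraction of \<open>coth\<close>.\<close>

lemma nonneg_of_deriv_nonneg:
  fixes y z :: "real \<Rightarrow> real"
  assumes "\<And>t. (y has_real_derivative t * z t) (at t)" "\<And>t. t \<ge> 0 \<Longrightarrow> z t \<ge> 0" "y 0 = 0" "c \<ge> 0"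
  shows "y c \<ge> 0"
proof -
  have "y 0 \<le> y c"
    by (rule DERIV_nonneg_imp_nondecreasing[OF assms(4)]) (use assms(1,2) in fastforce)
  with assms(3) show ?thesis by simp
qed

lemma sinh_cosh_Bessel_bounds:
  fixes c :: real
  assumes "c \<ge> 0"
  shows "(3 + c^2) * sinh c - 3 * c * cosh c \<ge> 0"
    and "c * (15 + c^2) * cosh c - (15 + 6 * c^2) * sinh c \<ge> 0"
    and "(105 + 45 * c^2 + c^4) * sinh c - (105 * c + 10 * c^3) * cosh c \<ge> 0"
proof -
  have y1: "t * cosh t - sinh t \<ge> 0" if "t \<ge> 0" for t :: real
    using that by (intro nonneg_of_deriv_nonneg[where y = "\<lambda>t. t * cosh t - sinh t" and z = sinh])
      (auto intro!: derivative_eq_intros)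
  have y2: "(3 + t^2) * sinh t - 3 * t * cosh t \<ge> 0" if "t \<ge> 0" for t :: real
    using that y1
    by (intro nonneg_of_deriv_nonneg[where y = "\<lambda>t. (3 + t^2) * sinh t - 3 * t * cosh t"
         and z = "\<lambda>t. t * cosh t - sinh t"])
      (auto intro!: derivative_eq_intros simp: algebra_simps power2_eq_square)
  have y3: "t * (15 + t^2) * cosh t - (15 + 6 * t^2) * sinh t \<ge> 0" if "t \<ge> 0" for t :: real
    using that y2
    by (intro nonneg_of_deriv_nonneg[where y = "\<lambda>t. t * (15 + t^2) * cosh t - (15 + 6 * t^2) * sinh t"
         and z = "\<lambda>t. (3 + t^2) * sinh t - 3 * t * cosh t"])
      (auto intro!: derivative_eq_intros simp: algebra_simps power2_eq_square power3_eq_cube)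
  have y4: "(105 + 45 * t^2 + t^4) * sinh t - (105 * t + 10 * t^3) * cosh t \<ge> 0" if "t \<ge> 0" for t :: real
    using that y3
    by (intro nonneg_of_deriv_nonneg[where y = "\<lambda>t. (105 + 45 * t^2 + t^4) * sinh t - (105 * t + 10 * t^3) * cosh t"
         and z = "\<lambda>t. t * (15 + t^2) * cosh t - (15 + 6 * t^2) * sinh t"])
      (auto intro!: derivative_eq_intros simp: algebra_simps eval_nat_numeral)
  show "(3 + c^2) * sinh c - 3 * c * cosh c \<ge> 0"
    and "c * (15 + c^2) * cosh c - (15 + 6 * c^2) * sinh c \<ge> 0"
    and "(105 + 45 * c^2 + c^4) * sinh c - (105 * c + 10 * c^3) * cosh c \<ge> 0"
    using y2 y3 y4 assms by auto
qed

lemma mean_log_mgf_minus: "mean_log_mgf (- c) = mean_log_mgf c"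
proof (cases "c = 0")
  case False
  then have "sinh c \<noteq> 0" by simp
  moreover have "mean_log_mgf (- c) * sinh c = mean_log_mgf c * sinh c"
    using mean_log_mgf_sinh[of c] mean_log_mgf_sinh[of "-c"] by simp
  ultimately show ?thesis by simp
qed simp

text \<open>Substituting \<open>c cosh c = (m + 1) sinh c\<close> into the three inequalities for
  \<open>sinh\<close> and \<open>cosh\<close> and cancelling \<open>sinh c > 0\<close> gives the
  claim for positive \<open>c\<close>; evenness does the rest. The first and third bound share the
  expansion \<open>c^2/3 - c^4/45\<close> up to order 4, which settles the critical case.\<close>

lemma mean_log_mgf_bounds:
  shows "5 * c^2 / (15 + c^2) \<le> mean_log_mgf c"
    and "mean_log_mgf c \<le> c^2 / 3"
    and "mean_log_mgf c \<le> c^2 * (35 + c^2) / (105 + 10 * c^2)"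
proof -
  have *: "5 * c^2 / (15 + c^2) \<le> mean_log_mgf c \<and> mean_log_mgf c \<le> c^2 / 3
     \<and> mean_log_mgf c \<le> c^2 * (35 + c^2) / (105 + 10 * c^2)" if c: "c > 0" for c
  proof -
    define S where "S = sinh c"
    define m where "m = mean_log_mgf c"
    have S: "S > 0" unfolding S_def using c by simp
    have ch: "c * cosh c = (m + 1) * S"
      using mean_log_mgf_sinh[of c] unfolding S_def m_def by (simp add: algebra_simps)
    note b = sinh_cosh_Bessel_bounds[of c, OF less_imp_le[OF c]]
    have "S * (c^2 - 3 * m) = (3 + c^2) * sinh c - 3 * (c * cosh c)"
      unfolding ch S_def[symmetric] by (simp add: algebra_simps)
    then have 1: "c^2 - 3 * m \<ge> 0" using b(1) S by (metis mult.assoc zero_le_mult_iff not_less)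
    have "S * (m * (15 + c^2) - 5 * c^2) = (15 + c^2) * (c * cosh c) - (15 + 6 * c^2) * sinh c"
      unfolding ch S_def[symmetric] by (simp add: algebra_simps)
    also have "\<dots> \<ge> 0" using b(2) by (simp add: mult_ac)
    finally have 2: "m * (15 + c^2) - 5 * c^2 \<ge> 0" using S by (metis zero_le_mult_iff not_less)
    have "S * (c^2 * (35 + c^2) - m * (105 + 10 * c^2))
       = (105 + 45 * c^2 + c^4) * sinh c - (105 + 10 * c^2) * (c * cosh c)"
      unfolding ch S_def[symmetric] by (simp add: algebra_simps eval_nat_numeral)
    also have "\<dots> \<ge> 0" using b(3) by (simp add: algebra_simps eval_nat_numeral)
    finally have 3: "c^2 * (35 + c^2) - m * (105 + 10 * c^2) \<ge> 0" using S by (metis zero_le_mult_iff not_less)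
    have "15 + c^2 > 0" "105 + 10 * c^2 > 0" by (auto intro: add_pos_nonneg)
    with 1 2 3 show ?thesis unfolding m_def[symmetric] by (simp add: field_simps)
  qed
  have **: "5 * c^2 / (15 + c^2) \<le> mean_log_mgf c \<and> mean_log_mgf c \<le> c^2 / 3
     \<and> mean_log_mgf c \<le> c^2 * (35 + c^2) / (105 + 10 * c^2)"
  proof (cases c "0::real" rule: linorder_cases)
    case less
    then show ?thesis using *[of "-c"] mean_log_mgf_minus[of c] by simp
  next
    case equal
    then show ?thesis by simp
  next
    case greater
    then show ?thesis using *[of c] by simp
  qed
  then show "5 * c^2 / (15 + c^2) \<le> mean_log_mgf c"
    and "mean_log_mgf c \<le> c^2 / 3"
    and "mean_log_mgf c \<le> c^2 * (35 + c^2) / (105 + 10 * c^2)"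
    by auto
qed

text \<open>The admissible set is exactly the interval from 0 (excluded) to
  \<open>3 / (2 * J)\<close> (included): there the bound \<open>c^2 / 3\<close> gives nonnegativity,
  and beyond it the lower bound for \<open>mean_log_mgf\<close> makes \<open>G_fun\<close> negative
  at a small \<open>s\<close>.\<close>

lemma critical_beta_eq:
  assumes J: "J > 0"
  shows "critical_beta J = 3 / (2 * J)"
proof -
  have "{\<beta>. \<beta> > 0 \<and> (\<forall>s. G_fun J \<beta> s \<ge> 0)} = {0<..3 / (2 * J)}"
  proof (intro set_eqI iffI)
    fix \<beta> assume "\<beta> \<in> {0<..3 / (2 * J)}"
    then have \<beta>: "\<beta> > 0" "\<beta> * J \<le> 3 / 2" using J by (auto simp: field_simps)
    have "G_fun J \<beta> s \<ge> 0" for s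
    proof -
      have "mean_log_mgf (\<beta> * J * s) \<le> (\<beta> * J * s)^2 / 3" by (rule mean_log_mgf_bounds)
      also have "\<dots> = (\<beta> * J * s\<^sup>2 / 3) * (\<beta> * J)" by (simp add: power2_eq_square)
      also have "\<dots> \<le> (\<beta> * J * s\<^sup>2 / 3) * (3 / 2)" using \<beta> J by (intro mult_left_mono) auto
      finally show ?thesis unfolding G_fun_eq by simp
    qed
    with \<beta> show "\<beta> \<in> {\<beta>. \<beta> > 0 \<and> (\<forall>s. G_fun J \<beta> s \<ge> 0)}" by simp
  next
    fix \<beta> assume "\<beta> \<in> {\<beta>. \<beta> > 0 \<and> (\<forall>s. G_fun J \<beta> s \<ge> 0)}"
    then have \<beta>: "\<beta> > 0" "\<And>s. G_fun J \<beta> s \<ge> 0" by auto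
    have "\<beta> * J \<le> 3 / 2"
    proof (rule ccontr)
      assume "\<not> \<beta> * J \<le> 3 / 2"
      define b where "b = \<beta> * J"
      have b: "b > 3 / 2" unfolding b_def using \<open>\<not> _\<close> by simp
      \<comment> \<open>Nonnegativity at \<open>s = c / b\<close> would force
        \<open>10 * b \<le> 15 + c^2\<close>; half of the excess \<open>10 * b - 15\<close> is too
        small for that.\<close>
      define c where "c = sqrt ((10 * b - 15) / 2)"
      have c2: "c^2 = (10 * b - 15) / 2" unfolding c_def using b by simp
      have c2': "c^2 > 0" unfolding c2 using b by simp
      have "0 \<le> G_fun J \<beta> (c / b)" by (rule \<beta>)
      also have "\<dots> = c^2 / (2 * b) - mean_log_mgf c"
        unfolding G_fun_eq b_def[symmetric] using b by (simp add: power2_eq_square)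
      also have "\<dots> \<le> c^2 / (2 * b) - 5 * c^2 / (15 + c^2)"
        using mean_log_mgf_bounds(1)[of c] by simp
      finally have "5 * c^2 / (15 + c^2) \<le> c^2 / (2 * b)" by simp
      then have "5 * c^2 * (2 * b) \<le> c^2 * (15 + c^2)"
        using b c2' by (simp add: divide_simps)
      then have "c^2 * (10 * b) \<le> c^2 * (15 + c^2)" by (simp add: algebra_simps)
      then have "10 * b \<le> 15 + c^2" using c2' by simp
      then show False unfolding c2 using b by (simp add: field_simps)
    qed
    then show "\<beta> \<in> {0<..3 / (2 * J)}" using \<beta> J by (simp add: field_simps)
  qed
  then show ?thesis unfolding critical_beta_def using J by simp
qed

section \<open>The Hubbard-Stratonovich transform\<close>

lemma rotation_funpow:
  assumes "x \<in> {0..<1}"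
  shows "(rotation \<alpha> ^^ i) x = frac (x + real i * \<alpha>)"
proof (induction i)
  case 0
  then show ?case using assms by (simp add: frac_eq)
next
  case (Suc i)
  have "frac (frac (x + real i * \<alpha>) + \<alpha>) = frac (x + real i * \<alpha> + \<alpha>)"
    by (simp add: frac_def floor_add_int algebra_simps)
  then show ?case using Suc by (simp add: rotation_def algebra_simps)
qed

text \<open>The Fourier transform of an unnormalised Gaussian of mean \<open>m\<close> and variance
  \<open>1/A\<close>, obtained from the standard normal characteristic function by the substitution
  \<open>sqrt A * (u - m)\<close>.\<close>

lemma has_bochner_integral_gaussian_iexp:
  fixes A m \<theta> :: real
  assumes A: "A > 0"
  shows "has_bochner_integral lborel (\<lambda>u. iexp (\<theta> * u) * complex_of_real (exp (- (A * (u - m)\<^sup>2 / 2))))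
           (iexp (\<theta> * m) * complex_of_real (sqrt (2 * pi / A) * exp (- (\<theta>\<^sup>2 / (2 * A)))))"
proof -
  define \<tau> where "\<tau> = \<theta> / sqrt A"
  have "integrable lborel (\<lambda>x. std_normal_density x *\<^sub>R iexp (\<tau> * x))"
    by (rule Bochner_Integration.integrable_bound[OF integrable_normal_density[of 1 0]]) auto
  moreover have "(CLBINT x. std_normal_density x *\<^sub>R iexp (\<tau> * x)) = complex_of_real (exp (- (\<tau>\<^sup>2) / 2))"
    using fun_cong[OF char_std_normal_distribution, of \<tau>]
    by (simp add: char_def integral_density)
  ultimately have "has_bochner_integral lborel (\<lambda>x. std_normal_density x *\<^sub>R iexp (\<tau> * x))
      (complex_of_real (exp (- (\<tau>\<^sup>2) / 2)))"
    by (simp add: has_bochner_integral_iff)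
  then have "has_bochner_integral lborel
      (\<lambda>u. std_normal_density (- sqrt A * m + sqrt A * u) *\<^sub>R iexp (\<tau> * (- sqrt A * m + sqrt A * u)))
      (complex_of_real (exp (- (\<tau>\<^sup>2) / 2)) /\<^sub>R \<bar>sqrt A\<bar>)"
    using A by (subst (asm) lborel_has_bochner_integral_real_affine_iff[where c = "sqrt A" and t = "- sqrt A * m"]) auto
  from has_bochner_integral_mult_right[OF this, of "iexp (\<theta> * m) * complex_of_real (sqrt (2 * pi))"]
  show ?thesis
  proof (rule has_bochner_integral_cong[THEN iffD1, rotated -1])
    fix u
    have e: "- sqrt A * m + sqrt A * u = sqrt A * (u - m)" by (simp add: algebra_simps)
    have "\<theta> * m + \<tau> * (sqrt A * (u - m)) = \<theta> * u"
      unfolding \<tau>_def using A by (simp add: field_simps)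
    then have "iexp (\<theta> * m) * iexp (\<tau> * (sqrt A * (u - m))) = iexp (\<theta> * u)"
      by (simp only: exp_add[symmetric] distrib_left[symmetric] of_real_add[symmetric])
    then show "iexp (\<theta> * m) * complex_of_real (sqrt (2 * pi)) *
         (std_normal_density (- sqrt A * m + sqrt A * u) *\<^sub>R iexp (\<tau> * (- sqrt A * m + sqrt A * u)))
       = iexp (\<theta> * u) * complex_of_real (exp (- (A * (u - m)\<^sup>2 / 2)))"
      unfolding e using A
      by (simp add: std_normal_density_def scaleR_conv_of_real power_mult_distrib)
  next
    show "iexp (\<theta> * m) * complex_of_real (sqrt (2 * pi)) * (complex_of_real (exp (- (\<tau>\<^sup>2) / 2)) /\<^sub>R \<bar>sqrt A\<bar>)
       = iexp (\<theta> * m) * complex_of_real (sqrt (2 * pi / A) * exp (- (\<theta>\<^sup>2 / (2 * A))))"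
    proof -
      have "sqrt (2 * pi / A) * exp (- (\<theta>\<^sup>2 / (2 * A))) = sqrt (2 * pi) * (exp (- (\<tau>\<^sup>2) / 2) / sqrt A)"
        unfolding \<tau>_def using A by (simp add: power_divide real_sqrt_divide)
      moreover have "complex_of_real (exp (- (\<tau>\<^sup>2) / 2)) /\<^sub>R \<bar>sqrt A\<bar> = complex_of_real (exp (- (\<tau>\<^sup>2) / 2) / sqrt A)"
        using A by (simp add: scaleR_conv_of_real field_simps)
      ultimately show ?thesis by (simp only: of_real_mult mult.assoc)
    qed
  qed simp
qed

text \<open>Here \<open>f\<close> enters only through its values along the orbit, which must be
  probabilities; equidistribution is added in a later locale.\<close>

locale rotation_gibbs =
  fixes f :: "real \<Rightarrow> real" and \<alpha> x J \<beta> :: real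
  assumes prob: "\<And>i. 0 \<le> f ((rotation \<alpha> ^^ i) x)" "\<And>i. f ((rotation \<alpha> ^^ i) x) \<le> 1"
    and b: "\<beta> * J > 0"
begin

section \<open>The Gibbs measure as a probability measure on a finite set\<close>

lemma finite_spin_configs: "finite (spin_configs n)"
  unfolding spin_configs_def by (intro finite_PiE) auto

lemma spin_prob_nonneg: "spin_prob f \<alpha> x i s \<ge> 0"
  unfolding spin_prob_def using prob by auto

text \<open>The tilted weight factorizes over the sites, so the sum over configurations is a product
  of two-term sums. This is what the Hubbard-Stratonovich transform gains by linearizing the square
  of the magnetization.\<close>

lemma sum_tilted_spin_prob:
  "(\<Sum>\<sigma>\<in>spin_configs n. (\<Prod>i=1..n. spin_prob f \<alpha> x i (\<sigma> i)) * exp (c * (\<Sum>i=1..n. \<sigma> i)))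
     = exp (\<Sum>i=1..n. spin_log_mgf c (f ((rotation \<alpha> ^^ i) x)))"
proof -
  have "(\<Sum>\<sigma>\<in>spin_configs n. (\<Prod>i=1..n. spin_prob f \<alpha> x i (\<sigma> i)) * exp (c * (\<Sum>i=1..n. \<sigma> i)))
     = (\<Sum>\<sigma>\<in>spin_configs n. \<Prod>i=1..n. spin_prob f \<alpha> x i (\<sigma> i) * exp (c * \<sigma> i))"
    by (simp add: sum_distrib_left exp_sum prod.distrib)
  also have "\<dots> = (\<Prod>i=1..n. \<Sum>s\<in>{-1,1}. spin_prob f \<alpha> x i s * exp (c * s))"
    unfolding spin_configs_def by (rule prod_sum_PiE[symmetric]) auto
  also have "\<dots> = (\<Prod>i=1..n. exp (spin_log_mgf c (f ((rotation \<alpha> ^^ i) x))))"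
  proof (rule prod.cong)
    fix i
    show "(\<Sum>s\<in>{-1,1}. spin_prob f \<alpha> x i s * exp (c * s)) = exp (spin_log_mgf c (f ((rotation \<alpha> ^^ i) x)))"
      using spin_mgf_pos[OF prob, of i c] by (simp add: spin_prob_def spin_log_mgf_def)
  qed simp
  finally show ?thesis by (simp add: exp_sum)
qed

lemma gibbs_weight_nonneg: "gibbs_weight f \<alpha> J \<beta> n x \<sigma> \<ge> 0"
  unfolding gibbs_weight_def by (intro mult_nonneg_nonneg prod_nonneg) (auto simp: spin_prob_nonneg)

text \<open>Single weights may vanish when some spin probability is 0. Dropping the interaction
  factor, which is at least 1, leaves a product measure of total mass 1 (the tilted sum at
  \<open>c = 0\<close>).\<close>

lemma partition_function_pos: "(\<Sum>\<sigma>\<in>spin_configs n. gibbs_weight f \<alpha> J \<beta> n x \<sigma>) > 0"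
proof -
  have "(1::real) = (\<Sum>\<sigma>\<in>spin_configs n. \<Prod>i=1..n. spin_prob f \<alpha> x i (\<sigma> i))"
    using sum_tilted_spin_prob[of n 0] by (simp add: spin_log_mgf_def)
  also have "\<dots> \<le> (\<Sum>\<sigma>\<in>spin_configs n. gibbs_weight f \<alpha> J \<beta> n x \<sigma>)"
  proof (rule sum_mono)
    fix \<sigma>
    have "1 * (\<Prod>i=1..n. spin_prob f \<alpha> x i (\<sigma> i)) \<le> gibbs_weight f \<alpha> J \<beta> n x \<sigma>"
      unfolding gibbs_weight_def using b
      by (intro mult_right_mono prod_nonneg) (auto simp: spin_prob_nonneg)
    then show "(\<Prod>i=1..n. spin_prob f \<alpha> x i (\<sigma> i)) \<le> gibbs_weight f \<alpha> J \<beta> n x \<sigma>" by simp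
  qed
  finally show ?thesis by simp
qed

lemma prob_space_gibbs_measure: "prob_space (gibbs_measure f \<alpha> J \<beta> n x)"
proof
  let ?Z = "\<Sum>\<tau>\<in>spin_configs n. gibbs_weight f \<alpha> J \<beta> n x \<tau>"
  have "emeasure (gibbs_measure f \<alpha> J \<beta> n x) (space (gibbs_measure f \<alpha> J \<beta> n x))
     = (\<Sum>\<sigma>\<in>spin_configs n. ennreal (gibbs_weight f \<alpha> J \<beta> n x \<sigma> / ?Z))"
    unfolding gibbs_measure_def
    by (subst emeasure_point_measure_finite) (auto simp: finite_spin_configs space_point_measure)
  also have "\<dots> = ennreal (\<Sum>\<sigma>\<in>spin_configs n. gibbs_weight f \<alpha> J \<beta> n x \<sigma> / ?Z)"
    using partition_function_pos[of n] by (intro sum_ennreal) (auto simp: gibbs_weight_nonneg)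
  also have "\<dots> = 1"
    using partition_function_pos[of n] by (simp add: sum_divide_distrib[symmetric])
  finally show "emeasure (gibbs_measure f \<alpha> J \<beta> n x) (space (gibbs_measure f \<alpha> J \<beta> n x)) = 1" .
qed

lemma measurable_gibbs_measure [measurable]: "g \<in> borel_measurable (gibbs_measure f \<alpha> J \<beta> n x)"
  unfolding gibbs_measure_def by simp

lemma real_distribution_gibbs: "real_distribution (distr (gibbs_measure f \<alpha> J \<beta> n x) borel g)"
proof -
  interpret prob_space "gibbs_measure f \<alpha> J \<beta> n x" by (rule prob_space_gibbs_measure)
  show ?thesis by (rule real_distribution_distr) simp
qed

lemma char_distr_gibbs:
  "char (distr (gibbs_measure f \<alpha> J \<beta> n x) borel g) \<theta>
    = (\<Sum>\<sigma>\<in>spin_configs n. complex_of_real (gibbs_weight f \<alpha> J \<beta> n x \<sigma>) * iexp (\<theta> * g \<sigma>))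
      / complex_of_real (\<Sum>\<sigma>\<in>spin_configs n. gibbs_weight f \<alpha> J \<beta> n x \<sigma>)"
proof -
  let ?Z = "\<Sum>\<tau>\<in>spin_configs n. gibbs_weight f \<alpha> J \<beta> n x \<tau>"
  have "char (distr (gibbs_measure f \<alpha> J \<beta> n x) borel g) \<theta> = (CLINT \<sigma>|gibbs_measure f \<alpha> J \<beta> n x. iexp (\<theta> * g \<sigma>))"
    unfolding char_def by (rule integral_distr) auto
  also have "\<dots> = (\<Sum>\<sigma>\<in>spin_configs n. (gibbs_weight f \<alpha> J \<beta> n x \<sigma> / ?Z) *\<^sub>R iexp (\<theta> * g \<sigma>))"
    unfolding gibbs_measure_def using partition_function_pos[of n]
    by (subst lebesgue_integral_point_measure_finite) (auto simp: finite_spin_configs gibbs_weight_nonneg)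
  also have "\<dots> = (\<Sum>\<sigma>\<in>spin_configs n. complex_of_real (gibbs_weight f \<alpha> J \<beta> n x \<sigma>) * iexp (\<theta> * g \<sigma>) / complex_of_real ?Z)"
    by (intro sum.cong) (auto simp: scaleR_conv_of_real)
  finally show ?thesis by (simp add: sum_divide_distrib[symmetric])
qed

section \<open>Gaussian smoothing of the magnetization\<close>

definition HS_density :: "nat \<Rightarrow> real \<Rightarrow> real \<Rightarrow> real" where
  "HS_density n a u = exp (- (\<beta> * J * a\<^sup>2 / (2 * real n) * u\<^sup>2)
     + (\<Sum>i=1..n. spin_log_mgf (\<beta> * J * a * u / real n) (f ((rotation \<alpha> ^^ i) x))))"

text \<open>\<^term>\<open>HS_density n a\<close> is, up to a constant, the density of
  \<open>M\<^sub>n / a\<close> plus an independent centred Gaussian variable of variance \<open>n / (\<beta> J a\<^sup>2)\<close>.\<close>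

lemma HS_density_eq_mixture:
  assumes n: "n > 0" and a: "a > 0"
  shows "HS_density n a u = (\<Sum>\<sigma>\<in>spin_configs n. gibbs_weight f \<alpha> J \<beta> n x \<sigma> *
           exp (- (\<beta> * J * a\<^sup>2 / real n * (u - magnetization n \<sigma> / a)\<^sup>2 / 2)))"
proof -
  have "HS_density n a u = exp (- (\<beta> * J * a\<^sup>2 / (2 * real n) * u\<^sup>2)) *
      (\<Sum>\<sigma>\<in>spin_configs n. (\<Prod>i=1..n. spin_prob f \<alpha> x i (\<sigma> i)) * exp (\<beta> * J * a * u / real n * (\<Sum>i=1..n. \<sigma> i)))"
    unfolding sum_tilted_spin_prob HS_density_def by (simp only: exp_add)
  also have "\<dots> = (\<Sum>\<sigma>\<in>spin_configs n. gibbs_weight f \<alpha> J \<beta> n x \<sigma> *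
           exp (- (\<beta> * J * a\<^sup>2 / real n * (u - magnetization n \<sigma> / a)\<^sup>2 / 2)))"
  proof (subst sum_distrib_left, rule sum.cong)
    fix \<sigma>
    let ?M = "\<Sum>i=1..n. \<sigma> i" and ?P = "\<Prod>i=1..n. spin_prob f \<alpha> x i (\<sigma> i)"
    \<comment> \<open>Completing the square in \<open>u\<close>: the leftover term is exactly the
      mean-field interaction.\<close>
    have "- (\<beta> * J * a\<^sup>2 / (2 * real n) * u\<^sup>2) + \<beta> * J * a * u / real n * ?M
        = \<beta> * J / (2 * real n) * ?M\<^sup>2 + - (\<beta> * J * a\<^sup>2 / real n * (u - ?M / a)\<^sup>2 / 2)"
      using n a by (simp add: field_simps power2_eq_square)
    then have "exp (- (\<beta> * J * a\<^sup>2 / (2 * real n) * u\<^sup>2)) * exp (\<beta> * J * a * u / real n * ?M)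
        = exp (\<beta> * J / (2 * real n) * ?M\<^sup>2) * exp (- (\<beta> * J * a\<^sup>2 / real n * (u - ?M / a)\<^sup>2 / 2))"
      by (simp only: exp_add[symmetric])
    then show "exp (- (\<beta> * J * a\<^sup>2 / (2 * real n) * u\<^sup>2)) * (?P * exp (\<beta> * J * a * u / real n * ?M))
       = gibbs_weight f \<alpha> J \<beta> n x \<sigma> * exp (- (\<beta> * J * a\<^sup>2 / real n * (u - magnetization n \<sigma> / a)\<^sup>2 / 2))"
      unfolding gibbs_weight_def magnetization_def by (simp add: mult_ac)
  qed simp
  finally show ?thesis .
qed

text \<open>The mixture is integrated term by term. Every component is a Gaussian of the same
  variance centred at \<open>magnetization n \<sigma> / a\<close>, so the factor Gaussian in
  \<theta> is common and the remaining sum is the characteristic function times the partition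
  function.\<close>

lemma has_bochner_integral_HS_density:
  assumes n: "n > 0" and a: "a > 0"
  shows "has_bochner_integral lborel (\<lambda>u. iexp (\<theta> * u) * complex_of_real (HS_density n a u))
    (char (distr (gibbs_measure f \<alpha> J \<beta> n x) borel (\<lambda>\<sigma>. magnetization n \<sigma> / a)) \<theta>
      * complex_of_real (exp (- (\<theta>\<^sup>2 * real n / (2 * \<beta> * J * a\<^sup>2))))
      * complex_of_real (sqrt (2 * pi * real n / (\<beta> * J * a\<^sup>2)) * (\<Sum>\<sigma>\<in>spin_configs n. gibbs_weight f \<alpha> J \<beta> n x \<sigma>)))"
proof -
  let ?w = "gibbs_weight f \<alpha> J \<beta> n x" and ?A = "\<beta> * J * a\<^sup>2 / real n"
  have A: "?A > 0" using b n a by simp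
  have "has_bochner_integral lborel (\<lambda>u. \<Sum>\<sigma>\<in>spin_configs n. complex_of_real (?w \<sigma>) *
        (iexp (\<theta> * u) * complex_of_real (exp (- (?A * (u - magnetization n \<sigma> / a)\<^sup>2 / 2)))))
     (\<Sum>\<sigma>\<in>spin_configs n. complex_of_real (?w \<sigma>) *
        (iexp (\<theta> * (magnetization n \<sigma> / a)) * complex_of_real (sqrt (2 * pi / ?A) * exp (- (\<theta>\<^sup>2 / (2 * ?A))))))"
    by (intro has_bochner_integral_sum has_bochner_integral_mult_right has_bochner_integral_gaussian_iexp A)
  also have "(\<lambda>u. \<Sum>\<sigma>\<in>spin_configs n. complex_of_real (?w \<sigma>) *
        (iexp (\<theta> * u) * complex_of_real (exp (- (?A * (u - magnetization n \<sigma> / a)\<^sup>2 / 2)))))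
      = (\<lambda>u. iexp (\<theta> * u) * complex_of_real (HS_density n a u))"
    unfolding HS_density_eq_mixture[OF n a] by (simp add: sum_distrib_left mult_ac)
  also have "(\<Sum>\<sigma>\<in>spin_configs n. complex_of_real (?w \<sigma>) *
        (iexp (\<theta> * (magnetization n \<sigma> / a)) * complex_of_real (sqrt (2 * pi / ?A) * exp (- (\<theta>\<^sup>2 / (2 * ?A))))))
     = (\<Sum>\<sigma>\<in>spin_configs n. complex_of_real (?w \<sigma>) * iexp (\<theta> * (magnetization n \<sigma> / a)))
        * complex_of_real (sqrt (2 * pi / ?A) * exp (- (\<theta>\<^sup>2 / (2 * ?A))))"
    by (subst sum_distrib_right) (intro sum.cong refl, simp only: mult.assoc)
  also have "(\<Sum>\<sigma>\<in>spin_configs n. complex_of_real (?w \<sigma>) * iexp (\<theta> * (magnetization n \<sigma> / a)))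
     = char (distr (gibbs_measure f \<alpha> J \<beta> n x) borel (\<lambda>\<sigma>. magnetization n \<sigma> / a)) \<theta>
        * complex_of_real (\<Sum>\<sigma>\<in>spin_configs n. ?w \<sigma>)"
    unfolding char_distr_gibbs using partition_function_pos[of n] by (simp flip: of_real_sum)
  also have "2 * pi / ?A = 2 * pi * real n / (\<beta> * J * a\<^sup>2)" by simp
  also have "\<theta>\<^sup>2 / (2 * ?A) = \<theta>\<^sup>2 * real n / (2 * \<beta> * J * a\<^sup>2)" by simp
  finally show ?thesis by (simp add: mult_ac)
qed

text \<open>Dividing by the value at frequency 0 cancels the partition function and the Gaussian
  normalization; the last exponential divides out the auxiliary Gaussian.\<close>

lemma char_magnetization:
  assumes n: "n > 0" and a: "a > 0"
  shows "char (distr (gibbs_measure f \<alpha> J \<beta> n x) borel (\<lambda>\<sigma>. magnetization n \<sigma> / a)) \<theta>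
      = (CLBINT u. iexp (\<theta> * u) * complex_of_real (HS_density n a u))
        / (CLBINT u. complex_of_real (HS_density n a u))
        * complex_of_real (exp (\<theta>\<^sup>2 * real n / (2 * \<beta> * J * a\<^sup>2)))"
proof -
  interpret real_distribution "distr (gibbs_measure f \<alpha> J \<beta> n x) borel (\<lambda>\<sigma>. magnetization n \<sigma> / a)"
    by (rule real_distribution_gibbs)
  define N where "N = sqrt (2 * pi * real n / (\<beta> * J * a\<^sup>2)) * (\<Sum>\<sigma>\<in>spin_configs n. gibbs_weight f \<alpha> J \<beta> n x \<sigma>)"
  have "sqrt (2 * pi * real n / (\<beta> * J * a\<^sup>2)) > 0"
    using n a b by (intro real_sqrt_gt_zero divide_pos_pos mult_pos_pos[OF b]) auto
  then have "N > 0" unfolding N_def by (rule mult_pos_pos[OF _ partition_function_pos])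
  then have N: "N \<noteq> 0" by simp
  note I = has_bochner_integral_HS_density[OF n a, folded N_def, THEN has_bochner_integral_integral_eq]
  have 0: "(CLBINT u. complex_of_real (HS_density n a u)) = complex_of_real N"
    using I[of 0] by (simp add: char_zero)
  show ?thesis unfolding I 0 using N by (simp add: exp_minus)
qed

end

section \<open>Scaling limits\<close>

text \<open>Young's inequality absorbs \<open>l * \<bar>u\<bar>\<close> into half of the quadratic
  term. Such functions dominate the densities, the linear term coming from the discrepancy
  error.\<close>

lemma integrable_exp_neg_square_plus_abs:
  fixes k l m :: real
  assumes k: "k > 0"
  shows "integrable lborel (\<lambda>u. exp (m - k * u\<^sup>2 + l * \<bar>u\<bar>))"
proof (rule Bochner_Integration.integrable_bound)
  have "integrable lborel (\<lambda>u. complex_of_real (exp (- (k * u\<^sup>2 / 2))))"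
    using has_bochner_integral_gaussian_iexp[OF k, of 0 0] by (simp add: has_bochner_integral_iff)
  then have "integrable lborel (\<lambda>u. exp (- (k * u\<^sup>2 / 2)))"
    by (simp add: complex_of_real_integrable_eq)
  then show "integrable lborel (\<lambda>u. exp (m + l\<^sup>2 / (2 * k)) * exp (- (k * u\<^sup>2 / 2)))"
    by (rule integrable_mult_right)
  show "AE u in lborel. norm (exp (m - k * u\<^sup>2 + l * \<bar>u\<bar>)) \<le> norm (exp (m + l\<^sup>2 / (2 * k)) * exp (- (k * u\<^sup>2 / 2)))"
  proof (rule AE_I2)
    fix u :: real
    have "0 \<le> (k * \<bar>u\<bar> - l)\<^sup>2 / (2 * k)" using k by simp
    also have "(k * \<bar>u\<bar> - l)\<^sup>2 / (2 * k) = k * u\<^sup>2 / 2 - l * \<bar>u\<bar> + l\<^sup>2 / (2 * k)"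
      using k by (simp add: power2_diff field_simps power2_eq_square)
    finally have "m - k * u\<^sup>2 + l * \<bar>u\<bar> \<le> m + l\<^sup>2 / (2 * k) + - (k * u\<^sup>2 / 2)" by simp
    then show "norm (exp (m - k * u\<^sup>2 + l * \<bar>u\<bar>)) \<le> norm (exp (m + l\<^sup>2 / (2 * k)) * exp (- (k * u\<^sup>2 / 2)))"
      by (simp flip: exp_add)
  qed
qed simp

lemma eventually_sequentially_pos: "(\<And>n. n > 0 \<Longrightarrow> P n) \<Longrightarrow> eventually P sequentially"
  by (rule eventually_sequentiallyI[of 1]) auto

text \<open>Since \<open>n (c n)^2\<close> does not depend on \<open>n > 0\<close>, the bounds
  \<open>5 c^2 / (15 + c^2)\<close> and \<open>c^2 / 3\<close> squeeze the limit; the upper one also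
  holds for each \<open>n > 0\<close> and serves for domination. The coefficient
  \<open>b - 2 b^2 / 3\<close> is positive exactly when \<open>b < 3/2\<close>.\<close>

lemma free_energy_limit_subcritical:
  fixes b u :: real
  assumes b: "b > 0"
  defines "c \<equiv> \<lambda>n::nat. b * u * real n powr (- (1/2))"
  shows "(\<lambda>n. real n * (mean_log_mgf (c n) - (c n)\<^sup>2 / (2 * b))) \<longlonglongrightarrow> - ((b - 2 * b\<^sup>2 / 3) * u\<^sup>2 / 2)"
    and "n > 0 \<Longrightarrow> real n * (mean_log_mgf (c n) - (c n)\<^sup>2 / (2 * b)) \<le> - ((b - 2 * b\<^sup>2 / 3) * u\<^sup>2 / 2)"
proof -
  have nc: "real n * (c n)\<^sup>2 = b\<^sup>2 * u\<^sup>2" if "n > 0" for n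
  proof -
    have "(real n powr (- (1/2)))\<^sup>2 = 1 / real n"
      using that by (subst powr_power) (auto simp: powr_minus_divide)
    then show ?thesis using that by (simp add: c_def power_mult_distrib)
  qed
  have c2: "(c n)\<^sup>2 = b\<^sup>2 * u\<^sup>2 / real n" if "n > 0" for n
    using nc[OF that] that by (simp add: field_simps)
  have eq: "real n * (mean_log_mgf (c n) - (c n)\<^sup>2 / (2 * b)) = real n * mean_log_mgf (c n) - b * u\<^sup>2 / 2" if "n > 0" for n
  proof -
    have "real n * (mean_log_mgf (c n) - (c n)\<^sup>2 / (2 * b)) = real n * mean_log_mgf (c n) - (real n * (c n)\<^sup>2) / (2 * b)"
      by (simp add: algebra_simps)
    then show ?thesis unfolding nc[OF that] using b by (simp add: power2_eq_square)
  qed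
  have upper: "real n * mean_log_mgf (c n) \<le> b\<^sup>2 * u\<^sup>2 / 3" if "n > 0" for n
    using mult_left_mono[OF mean_log_mgf_bounds(2)[of "c n"], of "real n"] nc[OF that] by simp
  have lower: "5 * (b\<^sup>2 * u\<^sup>2) / (15 + b\<^sup>2 * u\<^sup>2 / real n) \<le> real n * mean_log_mgf (c n)" if "n > 0" for n
  proof -
    have "5 * (b\<^sup>2 * u\<^sup>2) / (15 + b\<^sup>2 * u\<^sup>2 / real n) = real n * (5 * (c n)\<^sup>2 / (15 + (c n)\<^sup>2))"
      unfolding c2[OF that] using that by simp
    then show ?thesis
      using mult_left_mono[OF mean_log_mgf_bounds(1)[of "c n"], of "real n"] by simp
  qed
  have "(\<lambda>n. 5 * (b\<^sup>2 * u\<^sup>2) / (15 + b\<^sup>2 * u\<^sup>2 / real n)) \<longlonglongrightarrow> 5 * (b\<^sup>2 * u\<^sup>2) / (15 + 0)"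
    by (intro tendsto_intros lim_const_over_n) simp
  then have l: "(\<lambda>n. 5 * (b\<^sup>2 * u\<^sup>2) / (15 + b\<^sup>2 * u\<^sup>2 / real n)) \<longlonglongrightarrow> b\<^sup>2 * u\<^sup>2 / 3" by simp
  have "(\<lambda>n. real n * mean_log_mgf (c n)) \<longlonglongrightarrow> b\<^sup>2 * u\<^sup>2 / 3"
  proof (rule tendsto_sandwich[OF _ _ l tendsto_const])
    show "\<forall>\<^sub>F n in sequentially. 5 * (b\<^sup>2 * u\<^sup>2) / (15 + b\<^sup>2 * u\<^sup>2 / real n) \<le> real n * mean_log_mgf (c n)"
      by (rule eventually_sequentially_pos[OF lower])
    show "\<forall>\<^sub>F n in sequentially. real n * mean_log_mgf (c n) \<le> b\<^sup>2 * u\<^sup>2 / 3"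
      by (rule eventually_sequentially_pos[OF upper])
  qed
  then have "(\<lambda>n. real n * mean_log_mgf (c n) - b * u\<^sup>2 / 2) \<longlonglongrightarrow> b\<^sup>2 * u\<^sup>2 / 3 - b * u\<^sup>2 / 2"
    by (intro tendsto_intros)
  moreover have "b\<^sup>2 * u\<^sup>2 / 3 - b * u\<^sup>2 / 2 = - ((b - 2 * b\<^sup>2 / 3) * u\<^sup>2 / 2)"
    by (simp add: field_simps)
  ultimately show "(\<lambda>n. real n * (mean_log_mgf (c n) - (c n)\<^sup>2 / (2 * b))) \<longlonglongrightarrow> - ((b - 2 * b\<^sup>2 / 3) * u\<^sup>2 / 2)"
    using tendsto_cong[OF eventually_sequentially_pos[OF eq]] by simp
  show "real n * (mean_log_mgf (c n) - (c n)\<^sup>2 / (2 * b)) \<le> - ((b - 2 * b\<^sup>2 / 3) * u\<^sup>2 / 2)" if "n > 0"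
    using upper[OF that] unfolding eq[OF that] by (simp add: field_simps)
qed

text \<open>At \<open>\<beta> * J = 3/2\<close> the quadratic part \<open>c^2 / 3\<close> cancels
  against the Gaussian term. What remains has leading coefficient \<open>-1/45\<close> in both
  rational bounds.\<close>

lemma mean_log_mgf_quartic_bounds:
  shows "- (c^4) / (45 + 3 * c\<^sup>2) \<le> mean_log_mgf c - c\<^sup>2 / 3"
    and "mean_log_mgf c - c\<^sup>2 / 3 \<le> - (c^4) / (45 + 30 / 7 * c\<^sup>2)"
proof -
  have pos: "15 + c\<^sup>2 > 0" "45 + 3 * c\<^sup>2 > 0" "105 + 10 * c\<^sup>2 > 0" "45 + 30 / 7 * c\<^sup>2 > 0"
    by (auto intro!: add_pos_nonneg)
  have "5 * c\<^sup>2 / (15 + c\<^sup>2) - c\<^sup>2 / 3 = - (c^4) / (45 + 3 * c\<^sup>2)"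
    using pos by (simp add: divide_simps) (simp add: algebra_simps eval_nat_numeral)
  then show "- (c^4) / (45 + 3 * c\<^sup>2) \<le> mean_log_mgf c - c\<^sup>2 / 3"
    using mean_log_mgf_bounds(1)[of c] by linarith
  have "c\<^sup>2 * (35 + c\<^sup>2) / (105 + 10 * c\<^sup>2) - c\<^sup>2 / 3 = - (c^4) / (45 + 30 / 7 * c\<^sup>2)"
    using pos by (simp add: divide_simps) (simp add: algebra_simps eval_nat_numeral)
  then show "mean_log_mgf c - c\<^sup>2 / 3 \<le> - (c^4) / (45 + 30 / 7 * c\<^sup>2)"
    using mean_log_mgf_bounds(3)[of c] by linarith
qed

text \<open>Now \<open>n (c n)^4 = 81/16 u^4\<close> for \<open>n > 0\<close> and \<open>c n\<close>
  tends to 0, so the limit is \<open>-81 / (16 * 45) u^4\<close>. The bound that is uniform in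
  \<open>n\<close> decays only quadratically in \<open>u\<close>, which suffices for
  domination.\<close>

lemma free_energy_limit_critical:
  fixes u :: real
  defines "c \<equiv> \<lambda>n::nat. 3 / 2 * u * real n powr (- (1/4))"
  shows "(\<lambda>n. real n * (mean_log_mgf (c n) - (c n)\<^sup>2 / (2 * (3 / 2)))) \<longlonglongrightarrow> - 9 * u^4 / 80"
    and "n > 0 \<Longrightarrow> real n * (mean_log_mgf (c n) - (c n)\<^sup>2 / (2 * (3 / 2))) \<le> 5 - 9 / 40 * u\<^sup>2"
proof -
  have nc: "real n * (c n)^4 = 81 / 16 * u^4" if "n > 0" for n
  proof -
    have "(real n powr (- (1/4)))^4 = 1 / real n"
      using that by (subst powr_power) (auto simp: powr_minus_divide)
    then show ?thesis using that by (simp add: c_def power_mult_distrib power_divide)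
  qed
  have c2: "(c n)\<^sup>2 = 9 / 4 * u\<^sup>2 * real n powr (- (1/2))" for n
  proof -
    have "(real n powr (- (1/4)))\<^sup>2 = real n powr (- (1/2))"
      by (cases "n = 0") (simp, subst powr_power, auto)
    then show ?thesis by (simp add: c_def power_mult_distrib power_divide)
  qed
  have lower: "- (81 / 16 * u^4) / (45 + 3 * (c n)\<^sup>2) \<le> real n * (mean_log_mgf (c n) - (c n)\<^sup>2 / 3)"
    if "n > 0" for n
    using mult_left_mono[OF mean_log_mgf_quartic_bounds(1)[of "c n"], of "real n"] nc[OF that] by simp
  have upper: "real n * (mean_log_mgf (c n) - (c n)\<^sup>2 / 3) \<le> - (81 / 16 * u^4) / (45 + 30 / 7 * (c n)\<^sup>2)"
    if "n > 0" for n
    using mult_left_mono[OF mean_log_mgf_quartic_bounds(2)[of "c n"], of "real n"] nc[OF that] by simp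
  have "(\<lambda>n. real n powr (- (1/2))) \<longlonglongrightarrow> 0"
    by (intro tendsto_neg_powr filterlim_real_sequentially) simp
  then have "(\<lambda>n. 9 / 4 * u\<^sup>2 * real n powr (- (1/2))) \<longlonglongrightarrow> 9 / 4 * u\<^sup>2 * 0" by (intro tendsto_intros)
  then have c0: "(\<lambda>n. (c n)\<^sup>2) \<longlonglongrightarrow> 0" unfolding c2 by simp
  have l: "(\<lambda>n. - (81 / 16 * u^4) / (45 + 3 * (c n)\<^sup>2)) \<longlonglongrightarrow> - (81 / 16 * u^4) / (45 + 3 * 0)"
    by (intro tendsto_intros c0) simp
  have r: "(\<lambda>n. - (81 / 16 * u^4) / (45 + 30 / 7 * (c n)\<^sup>2)) \<longlonglongrightarrow> - (81 / 16 * u^4) / (45 + 30 / 7 * 0)"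
    by (intro tendsto_intros c0) simp
  have "(\<lambda>n. real n * (mean_log_mgf (c n) - (c n)\<^sup>2 / 3)) \<longlonglongrightarrow> - (81 / 16 * u^4) / (45 + 3 * 0)"
  proof (rule tendsto_sandwich[OF _ _ l])
    show "\<forall>\<^sub>F n in sequentially. - (81 / 16 * u^4) / (45 + 3 * (c n)\<^sup>2) \<le> real n * (mean_log_mgf (c n) - (c n)\<^sup>2 / 3)"
      by (rule eventually_sequentially_pos[OF lower])
    show "\<forall>\<^sub>F n in sequentially. real n * (mean_log_mgf (c n) - (c n)\<^sup>2 / 3) \<le> - (81 / 16 * u^4) / (45 + 30 / 7 * (c n)\<^sup>2)"
      by (rule eventually_sequentially_pos[OF upper])
  qed (use r in simp)
  then show "(\<lambda>n. real n * (mean_log_mgf (c n) - (c n)\<^sup>2 / (2 * (3 / 2)))) \<longlonglongrightarrow> - 9 * u^4 / 80" by simp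
  show "real n * (mean_log_mgf (c n) - (c n)\<^sup>2 / (2 * (3 / 2))) \<le> 5 - 9 / 40 * u\<^sup>2" if n: "n > 0"
  proof -
    define v where "v = 9 / 4 * u\<^sup>2"
    have v: "v \<ge> 0" "81 / 16 * u^4 = v\<^sup>2" unfolding v_def by (simp_all add: power_mult_distrib power_divide)
    have "real n powr (- (1/2)) \<le> real n powr 0" using n by (intro powr_mono) auto
    then have cv: "(c n)\<^sup>2 \<le> v" unfolding c2 v_def using n by (intro mult_left_le) auto
    \<comment> \<open>An affine minorant of \<open>v^2 / (45 + 30/7 v)\<close>, which grows like
      \<open>7/30 v\<close>; slope \<open>1/10\<close> and offset 5 leave ample room, and
      \<open>v / 10 = 9/40 u^2\<close>.\<close>
    have "(v / 10 - 5) * (45 + 30 / 7 * v) \<le> v\<^sup>2"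
    proof -
      have "(v / 10 - 5) * (45 + 30 / 7 * v) = 3 / 7 * v\<^sup>2 - (237 / 14) * v - 225"
        by (simp add: field_simps power2_eq_square)
      also have "\<dots> \<le> 3 / 7 * v\<^sup>2" using v(1) by simp
      also have "\<dots> \<le> v\<^sup>2" by simp
      finally show ?thesis .
    qed
    then have "v / 10 - 5 \<le> v\<^sup>2 / (45 + 30 / 7 * v)"
      using v by (subst pos_le_divide_eq) (auto intro: add_pos_nonneg)
    also have "\<dots> \<le> v\<^sup>2 / (45 + 30 / 7 * (c n)\<^sup>2)"
      using cv v by (intro divide_left_mono mult_pos_pos add_pos_nonneg) auto
    finally show ?thesis using upper[OF n] unfolding v(2) by (simp add: v_def)
  qed
qed

section \<open>From pointwise limits of the smoothed densities to weak convergence\<close>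

lemma spin_log_mgf_measurable [measurable (raw)]:
  assumes [measurable]: "g \<in> borel_measurable M"
  shows "(\<lambda>u. spin_log_mgf (g u) t) \<in> borel_measurable M"
  unfolding spin_log_mgf_def by simp

context rotation_gibbs
begin

lemma HS_density_measurable [measurable]: "HS_density n a \<in> borel_measurable borel"
  unfolding HS_density_def[abs_def] by simp

text \<open>Dominated convergence in the numerator and the denominator of
  \<open>char_magnetization\<close>. The frequency may vary with \<open>n\<close>: a constant
  sequence serves the scale \<open>a n\<close>, a null sequence the law of large numbers.\<close>

lemma char_magnetization_tendsto:
  fixes a \<theta> :: "nat \<Rightarrow> real" and F D :: "real \<Rightarrow> real"
  assumes a: "\<And>n. n > 0 \<Longrightarrow> a n > 0"
    and conv: "\<And>u. (\<lambda>n. HS_density n (a n) u) \<longlonglongrightarrow> F u"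
    and dom: "\<And>n u. n > 0 \<Longrightarrow> HS_density n (a n) u \<le> D u"
    and D: "integrable lborel D"
    and F0: "(CLBINT u. complex_of_real (F u)) \<noteq> 0"
    and \<theta>: "\<theta> \<longlonglongrightarrow> \<theta>\<^sub>0"
    and \<kappa>: "(\<lambda>n. (\<theta> n)\<^sup>2 * real n / (2 * \<beta> * J * (a n)\<^sup>2)) \<longlonglongrightarrow> \<kappa>"
  shows "(\<lambda>n. char (distr (gibbs_measure f \<alpha> J \<beta> n x) borel (\<lambda>\<sigma>. magnetization n \<sigma> / a n)) (\<theta> n))
     \<longlonglongrightarrow> (CLBINT u. iexp (\<theta>\<^sub>0 * u) * complex_of_real (F u)) / (CLBINT u. complex_of_real (F u))
          * complex_of_real (exp \<kappa>)"
proof -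
  have [measurable]: "F \<in> borel_measurable borel"
    by (rule borel_measurable_LIMSEQ_real[OF conv]) simp_all
  \<comment> \<open>The shift to \<open>Suc n\<close> is due to the domination, which is assumed for
    positive \<open>n\<close> only.\<close>
  have int: "(\<lambda>n. CLBINT u. iexp (\<tau> (Suc n) * u) * complex_of_real (HS_density (Suc n) (a (Suc n)) u))
      \<longlonglongrightarrow> (CLBINT u. iexp (\<tau>\<^sub>0 * u) * complex_of_real (F u))" if \<tau>: "\<tau> \<longlonglongrightarrow> \<tau>\<^sub>0" for \<tau> \<tau>\<^sub>0
  proof (rule integral_dominated_convergence[OF _ _ D])
    show "AE u in lborel. (\<lambda>n. iexp (\<tau> (Suc n) * u) * complex_of_real (HS_density (Suc n) (a (Suc n)) u))
         \<longlonglongrightarrow> iexp (\<tau>\<^sub>0 * u) * complex_of_real (F u)"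
      using LIMSEQ_Suc[OF \<tau>] LIMSEQ_Suc[OF conv] by (intro AE_I2 tendsto_intros)
    show "AE u in lborel. norm (iexp (\<tau> (Suc n) * u) * complex_of_real (HS_density (Suc n) (a (Suc n)) u)) \<le> D u" for n
      using dom[of "Suc n"] by (intro AE_I2) (simp add: norm_mult HS_density_def)
    show "(\<lambda>u. iexp (\<tau>\<^sub>0 * u) * complex_of_real (F u)) \<in> borel_measurable lborel"
      by simp
    show "(\<lambda>u. iexp (\<tau> (Suc n) * u) * complex_of_real (HS_density (Suc n) (a (Suc n)) u)) \<in> borel_measurable lborel" for n
      by simp
  qed
  have "(\<lambda>n. CLBINT u. complex_of_real (HS_density (Suc n) (a (Suc n)) u)) \<longlonglongrightarrow> (CLBINT u. complex_of_real (F u))"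
    using int[OF tendsto_const[of 0]] by simp
  with int[OF \<theta>] have "(\<lambda>n. (CLBINT u. iexp (\<theta> (Suc n) * u) * complex_of_real (HS_density (Suc n) (a (Suc n)) u))
        / (CLBINT u. complex_of_real (HS_density (Suc n) (a (Suc n)) u))
        * complex_of_real (exp ((\<theta> (Suc n))\<^sup>2 * real (Suc n) / (2 * \<beta> * J * (a (Suc n))\<^sup>2))))
     \<longlonglongrightarrow> (CLBINT u. iexp (\<theta>\<^sub>0 * u) * complex_of_real (F u)) / (CLBINT u. complex_of_real (F u))
          * complex_of_real (exp \<kappa>)"
    by (intro tendsto_intros F0 LIMSEQ_Suc[OF \<kappa>])
  then have "(\<lambda>n. char (distr (gibbs_measure f \<alpha> J \<beta> (Suc n) x) borel (\<lambda>\<sigma>. magnetization (Suc n) \<sigma> / a (Suc n))) (\<theta> (Suc n)))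
     \<longlonglongrightarrow> (CLBINT u. iexp (\<theta>\<^sub>0 * u) * complex_of_real (F u)) / (CLBINT u. complex_of_real (F u))
          * complex_of_real (exp \<kappa>)"
    using char_magnetization[OF zero_less_Suc a[OF zero_less_Suc]] by simp
  then show ?thesis by (rule LIMSEQ_imp_Suc)
qed

end

text \<open>\<open>K\<close> and \<delta> are the constant and the exponent supplied by
  \<open>orbit_sum_discrepancy\<close>.\<close>

locale equidistributed_rotation_gibbs = rotation_gibbs +
  fixes K \<delta> :: real
  assumes orbit: "\<And>i. f ((rotation \<alpha> ^^ i) x) = frac (x + real i * \<alpha>)"
    and discrepancy: "\<And>(g::real \<Rightarrow> real) y n. mono_on {0..1} g \<Longrightarrow> g integrable_on {0..1} \<Longrightarrow>
       \<bar>(\<Sum>i<n. g (frac (y + real i * \<alpha>))) - real n * integral {0..1} g\<bar> \<le> K * (g 1 - g 0) * real n powr \<delta>"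
    and K: "K \<ge> 0"
begin

text \<open>The total variation of \<open>spin_log_mgf c\<close> on [0,1] is
  \<open>2 * \<bar>c\<bar>\<close>. The sum starts at \<open>i = 1\<close>, so the orbit is started
  at \<open>x + \<alpha>\<close>; for negative \<open>c\<close> the negated function is
  used.\<close>

lemma sum_spin_log_mgf_approx:
  "\<bar>(\<Sum>i=1..n. spin_log_mgf c (f ((rotation \<alpha> ^^ i) x))) - real n * mean_log_mgf c\<bar>
     \<le> 2 * K * \<bar>c\<bar> * real n powr \<delta>"
proof -
  have S: "(\<Sum>i=1..n. spin_log_mgf c (f ((rotation \<alpha> ^^ i) x)))
      = (\<Sum>i<n. spin_log_mgf c (frac ((x + \<alpha>) + real i * \<alpha>)))"
    unfolding One_nat_def sum.atLeast1_atMost_eq orbit by (simp add: algebra_simps)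
  show ?thesis
  proof (cases "c \<ge> 0")
    case True
    then show ?thesis
      using discrepancy[OF mono_on_spin_log_mgf spin_log_mgf_integrable, of c "x + \<alpha>" n]
      unfolding S mean_log_mgf_def by (simp add: mult_ac)
  next
    case False
    then have "\<bar>- (\<Sum>i<n. spin_log_mgf c (frac ((x + \<alpha>) + real i * \<alpha>))) - - (real n * mean_log_mgf c)\<bar>
       \<le> 2 * K * \<bar>c\<bar> * real n powr \<delta>"
      using discrepancy[OF mono_on_spin_log_mgf_neg integrable_neg[OF spin_log_mgf_integrable], of c "x + \<alpha>" n]
      unfolding mean_log_mgf_def by (simp add: sum_negf mult_ac)
    then show ?thesis unfolding S by (simp add: abs_minus_commute)
  qed
qed

text \<open>At the scale \<open>a = n powr (1 - \<gamma>)\<close> the tilt is \<open>c\<close> and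
  the Gaussian term is \<open>n c^2 / (2 \<beta> J)\<close>. Only the discrepancy of the orbit sum
  remains, of order \<open>\<bar>c\<bar> * n powr \<delta>\<close>.\<close>

lemma ln_HS_density_approx:
  fixes \<gamma> u :: real
  assumes n: "n > 0"
  defines "c \<equiv> \<beta> * J * u * real n powr (- \<gamma>)"
  shows "\<bar>ln (HS_density n (real n powr (1 - \<gamma>)) u) - real n * (mean_log_mgf c - c\<^sup>2 / (2 * (\<beta> * J)))\<bar>
     \<le> 2 * K * (\<beta> * J) * \<bar>u\<bar> * real n powr (\<delta> - \<gamma>)"
proof -
  define b where "b = \<beta> * J"
  have b0: "b > 0" unfolding b_def by (rule b)
  have p: "real n powr (1 - \<gamma>) = real n * real n powr (- \<gamma>)"
    using n by (simp add: powr_diff powr_minus divide_inverse)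
  have c: "\<beta> * J * real n powr (1 - \<gamma>) * u / real n = c"
    unfolding p c_def using n by simp
  have q: "b * (real n powr (1 - \<gamma>))\<^sup>2 / (2 * real n) * u\<^sup>2 = real n * c\<^sup>2 / (2 * b)"
    unfolding p c_def b_def[symmetric] using n b0 by (simp add: field_simps power2_eq_square)
  have "ln (HS_density n (real n powr (1 - \<gamma>)) u) - real n * (mean_log_mgf c - c\<^sup>2 / (2 * b))
     = (\<Sum>i=1..n. spin_log_mgf c (f ((rotation \<alpha> ^^ i) x))) - real n * mean_log_mgf c"
    unfolding HS_density_def c unfolding b_def[symmetric] q by (simp add: algebra_simps)
  then have "\<bar>ln (HS_density n (real n powr (1 - \<gamma>)) u) - real n * (mean_log_mgf c - c\<^sup>2 / (2 * b))\<bar>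
      \<le> 2 * K * \<bar>c\<bar> * real n powr \<delta>"
    using sum_spin_log_mgf_approx[of c n] by simp
  also have "2 * K * \<bar>c\<bar> * real n powr \<delta> = 2 * K * b * \<bar>u\<bar> * real n powr (\<delta> - \<gamma>)"
    using b0 unfolding c_def b_def[symmetric]
    by (simp add: abs_mult powr_diff powr_minus divide_inverse)
  finally show ?thesis unfolding b_def .
qed

text \<open>As \<open>\<delta> < \<gamma>\<close>, the discrepancy error vanishes in the limit and
  stays at most linear in \<open>u\<close> for every \<open>n > 0\<close>, so the densities converge
  to \<open>exp (L u)\<close> under a Gaussian-type bound and Levy's theorem applies.
  \<open>\<kappa>\<close> is half the limiting variance of the auxiliary Gaussian, which
  \<open>char_\<mu>\<close> divides out.\<close>

lemma weak_conv_scaled_magnetization: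
  fixes \<gamma> k k' \<kappa> :: real and L :: "real \<Rightarrow> real" and \<mu> :: "real measure"
  defines "c \<equiv> \<lambda>n u. \<beta> * J * u * real n powr (- \<gamma>)"
  assumes \<gamma>: "\<gamma> > 0" "\<delta> < \<gamma>" and k: "k > 0"
    and lim: "\<And>u. (\<lambda>n. real n * (mean_log_mgf (c n u) - (c n u)\<^sup>2 / (2 * (\<beta> * J)))) \<longlonglongrightarrow> L u"
    and bound: "\<And>n u. n > 0 \<Longrightarrow> real n * (mean_log_mgf (c n u) - (c n u)\<^sup>2 / (2 * (\<beta> * J))) \<le> k' - k * u\<^sup>2"
    and \<kappa>: "(\<lambda>n. real n powr (2 * \<gamma> - 1) / (2 * (\<beta> * J))) \<longlonglongrightarrow> \<kappa>"
    and L0: "(CLBINT u. complex_of_real (exp (L u))) \<noteq> 0"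
    and \<mu>: "real_distribution \<mu>"
    and char_\<mu>: "\<And>\<theta>. char \<mu> \<theta> = (CLBINT u. iexp (\<theta> * u) * complex_of_real (exp (L u)))
        / (CLBINT u. complex_of_real (exp (L u))) * complex_of_real (exp (\<theta>\<^sup>2 * \<kappa>))"
  shows "weak_conv_m (\<lambda>n. distr (gibbs_measure f \<alpha> J \<beta> n x) borel (\<lambda>\<sigma>. magnetization n \<sigma> / real n)) (return borel 0)"
    and "weak_conv_m (\<lambda>n. distr (gibbs_measure f \<alpha> J \<beta> n x) borel (\<lambda>\<sigma>. magnetization n \<sigma> / real n powr (1 - \<gamma>))) \<mu>"
proof -
  define a where "a n = real n powr (1 - \<gamma>)" for n
  have a: "a n > 0" if "n > 0" for n unfolding a_def using that by simp
  have pos: "HS_density n (a n) u > 0" for n u unfolding HS_density_def by simp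
  define P where "P n u = real n * (mean_log_mgf (c n u) - (c n u)\<^sup>2 / (2 * (\<beta> * J)))" for n u
  have approx: "\<bar>ln (HS_density n (a n) u) - P n u\<bar> \<le> 2 * K * (\<beta> * J) * \<bar>u\<bar> * real n powr (\<delta> - \<gamma>)"
    if "n > 0" for n u
    unfolding a_def P_def c_def using ln_HS_density_approx[OF that] .
  have conv: "(\<lambda>n. HS_density n (a n) u) \<longlonglongrightarrow> exp (L u)" for u
  proof -
    have "(\<lambda>n. real n powr (\<delta> - \<gamma>)) \<longlonglongrightarrow> 0"
      using \<gamma> by (intro tendsto_neg_powr filterlim_real_sequentially) simp
    then have "(\<lambda>n. 2 * K * (\<beta> * J) * \<bar>u\<bar> * real n powr (\<delta> - \<gamma>)) \<longlonglongrightarrow> 2 * K * (\<beta> * J) * \<bar>u\<bar> * 0"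
      by (intro tendsto_intros)
    then have B: "(\<lambda>n. 2 * K * (\<beta> * J) * \<bar>u\<bar> * real n powr (\<delta> - \<gamma>)) \<longlonglongrightarrow> 0" by simp
    have "(\<lambda>n. ln (HS_density n (a n) u) - P n u) \<longlonglongrightarrow> 0"
      by (rule Lim_null_comparison[OF _ B]) (rule eventually_sequentially_pos, simp add: approx)
    from tendsto_add[OF this lim[of u, folded P_def]]
    have "(\<lambda>n. ln (HS_density n (a n) u)) \<longlonglongrightarrow> L u" by simp
    from tendsto_exp[OF this] show ?thesis using pos by simp
  qed
  have dom: "HS_density n (a n) u \<le> exp (k' - k * u\<^sup>2 + 2 * K * (\<beta> * J) * \<bar>u\<bar>)" if n: "n > 0" for n u
  proof -
    have "real n powr (\<delta> - \<gamma>) \<le> real n powr 0" using n \<gamma> by (intro powr_mono) auto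
    then have "2 * K * (\<beta> * J) * \<bar>u\<bar> * real n powr (\<delta> - \<gamma>) \<le> 2 * K * (\<beta> * J) * \<bar>u\<bar>"
      using n K b by (intro mult_left_le) auto
    with approx[OF n, of u] bound[OF n, of u, folded P_def]
    have "ln (HS_density n (a n) u) \<le> k' - k * u\<^sup>2 + 2 * K * (\<beta> * J) * \<bar>u\<bar>" by linarith
    then show ?thesis using pos[of n u] by (simp add: ln_ge_iff flip: ln_le_cancel_iff)
  qed
  note tendsto = char_magnetization_tendsto[OF a conv dom integrable_exp_neg_square_plus_abs[OF k] L0]
  have na: "real n / (2 * \<beta> * J * (a n)\<^sup>2) = real n powr (2 * \<gamma> - 1) / (2 * (\<beta> * J))" for n
  proof (cases "n = 0")
    case False
    then have "(a n)\<^sup>2 = real n powr (2 - 2 * \<gamma>)" unfolding a_def by (simp add: powr_power algebra_simps)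
    also have "\<dots> = real n / real n powr (2 * \<gamma> - 1)" 
      using False powr_diff[of "real n" 1 "2 * \<gamma> - 1"] by simp
    finally show ?thesis using False by simp
  qed simp
  show "weak_conv_m (\<lambda>n. distr (gibbs_measure f \<alpha> J \<beta> n x) borel (\<lambda>\<sigma>. magnetization n \<sigma> / real n powr (1 - \<gamma>))) \<mu>"
  proof (rule levy_continuity[OF real_distribution_gibbs \<mu>])
    fix \<theta>
    have "(\<lambda>n. \<theta>\<^sup>2 * (real n / (2 * \<beta> * J * (a n)\<^sup>2))) \<longlonglongrightarrow> \<theta>\<^sup>2 * \<kappa>"
      unfolding na by (intro tendsto_intros \<kappa>)
    then have "(\<lambda>n. \<theta>\<^sup>2 * real n / (2 * \<beta> * J * (a n)\<^sup>2)) \<longlonglongrightarrow> \<theta>\<^sup>2 * \<kappa>" by simp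
    from tendsto[OF _ _ tendsto_const this]
    show "(\<lambda>n. char (distr (gibbs_measure f \<alpha> J \<beta> n x) borel (\<lambda>\<sigma>. magnetization n \<sigma> / real n powr (1 - \<gamma>))) \<theta>) \<longlonglongrightarrow> char \<mu> \<theta>"
      unfolding char_\<mu> a_def by simp
  qed
  have delta: "real_distribution (return borel (0::real))"
    unfolding real_distribution_def real_distribution_axioms_def by (auto intro: prob_space_return)
  show "weak_conv_m (\<lambda>n. distr (gibbs_measure f \<alpha> J \<beta> n x) borel (\<lambda>\<sigma>. magnetization n \<sigma> / real n)) (return borel 0)"
  proof (rule levy_continuity[OF real_distribution_gibbs delta])
    fix \<theta>
    \<comment> \<open>\<open>M_n / n\<close> at frequency \<theta> equals \<open>M_n / a n\<close>
      at this frequency. It tends to 0, where the limit takes the value 1, and the auxiliary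
      exponent is of order \<open>1/n\<close> for any \<gamma>.\<close>
    define \<tau> where "\<tau> n = \<theta> * real n powr (- \<gamma>)" for n :: nat
    have "(\<lambda>n. real n powr (- \<gamma>)) \<longlonglongrightarrow> 0"
      using \<gamma> by (intro tendsto_neg_powr filterlim_real_sequentially) simp
    then have \<tau>: "\<tau> \<longlonglongrightarrow> 0" unfolding \<tau>_def using tendsto_mult_right_zero by blast
    have eq: "(\<tau> n)\<^sup>2 * real n / (2 * \<beta> * J * (a n)\<^sup>2) = \<theta>\<^sup>2 / (2 * (\<beta> * J)) / real n" for n
    proof (cases "n = 0")
      case False
      have "(\<tau> n)\<^sup>2 * real n / (2 * \<beta> * J * (a n)\<^sup>2) = (\<tau> n)\<^sup>2 * (real n / (2 * \<beta> * J * (a n)\<^sup>2))" by simp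
      also have "\<dots> = \<theta>\<^sup>2 / (2 * (\<beta> * J)) * (real n powr (- 2 * \<gamma>) * real n powr (2 * \<gamma> - 1))"
      proof -
        have "(real n powr (- \<gamma>))\<^sup>2 = real n powr (- 2 * \<gamma>)"
          using False by (subst powr_power) (auto simp: mult.commute)
        then show ?thesis unfolding na \<tau>_def by (simp add: power_mult_distrib)
      qed
      also have "real n powr (- 2 * \<gamma>) * real n powr (2 * \<gamma> - 1) = 1 / real n"
        unfolding powr_add[symmetric] using False by (simp add: powr_minus_divide)
      finally show ?thesis by simp
    qed simp
    have "(\<lambda>n. (\<tau> n)\<^sup>2 * real n / (2 * \<beta> * J * (a n)\<^sup>2)) \<longlonglongrightarrow> 0"
      unfolding eq by (rule lim_const_over_n)
    from tendsto[OF _ _ \<tau> this] L0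
    have "(\<lambda>n. char (distr (gibbs_measure f \<alpha> J \<beta> n x) borel (\<lambda>\<sigma>. magnetization n \<sigma> / a n)) (\<tau> n)) \<longlonglongrightarrow> 1"
      by simp
    moreover have "char (distr (gibbs_measure f \<alpha> J \<beta> n x) borel (\<lambda>\<sigma>. magnetization n \<sigma> / a n)) (\<tau> n)
       = char (distr (gibbs_measure f \<alpha> J \<beta> n x) borel (\<lambda>\<sigma>. magnetization n \<sigma> / real n)) \<theta>" for n
    proof (cases "n = 0")
      case False
      have "\<tau> n * (m / a n) = \<theta> * (m / real n)" for m
        using False unfolding \<tau>_def a_def by (simp add: powr_diff powr_minus field_simps)
      then show ?thesis unfolding char_distr_gibbs by presburger
    qed (simp add: char_distr_gibbs a_def)
    moreover have "char (return borel 0) \<theta> = 1"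
      unfolding char_def by (subst integral_return) auto
    ultimately show "(\<lambda>n. char (distr (gibbs_measure f \<alpha> J \<beta> n x) borel (\<lambda>\<sigma>. magnetization n \<sigma> / real n)) \<theta>)
       \<longlonglongrightarrow> char (return borel 0) \<theta>" by simp
  qed
qed

end

section \<open>The limit distributions\<close>

text \<open>Euler's reflection formula at \<open>1/4\<close>, with
  \<open>sin (pi/4) = sqrt 2 / 2\<close>. It trades the \<open>Gamma (1/4)\<close> of the quartic
  integral for the \<open>Gamma (3/4)\<close> of the density.\<close>

lemma Gamma_quarter_reflection: "Gamma (1/4) * Gamma (3/4 :: real) = pi * sqrt 2"
proof -
  have eq: "1 - complex_of_real (1/4) = complex_of_real (3/4)" by simp
  have "complex_of_real (Gamma (1/4) * Gamma (3/4)) = complex_of_real pi / sin (complex_of_real pi * complex_of_real (1/4))"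
    using Gamma_reflection_complex[of "complex_of_real (1/4)"]
    unfolding eq Gamma_complex_of_real by (simp only: of_real_mult)
  also have "sin (complex_of_real pi * complex_of_real (1/4)) = complex_of_real (sin (pi * (1/4)))"
    by (simp only: of_real_mult[symmetric] sin_of_real)
  also have "complex_of_real pi / complex_of_real (sin (pi * (1/4))) = complex_of_real (pi / sin (pi * (1/4)))"
    by (simp only: of_real_divide)
  finally have "Gamma (1/4) * Gamma (3/4) = pi / sin (pi * (1/4))" by (simp only: of_real_eq_iff)
  also have "\<dots> = pi * (2 / sqrt 2)" by (simp add: sin_45)
  also have "2 / sqrt 2 = sqrt 2" by (rule real_div_sqrt) simp
  finally show ?thesis .
qed

text \<open>The substitution \<open>t = \<kappa> u^4\<close> in Euler's integral for
  \<open>Gamma (1/4)\<close> gives the half-line, and evenness doubles it. Integrability comes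
  first, from a Gaussian bound.\<close>

lemma has_bochner_integral_exp_quartic:
  fixes \<kappa> :: real
  assumes \<kappa>: "\<kappa> > 0"
  shows "has_bochner_integral lborel (\<lambda>u. exp (- (\<kappa> * u^4))) (Gamma (1/4) / (2 * \<kappa> powr (1/4)))"
proof -
  define E where "E u = exp (- (\<kappa> * u^4))" for u :: real
  have intE: "integrable lborel E"
  proof (rule Bochner_Integration.integrable_bound[OF integrable_exp_neg_square_plus_abs[OF \<kappa>, of \<kappa> 0]])
    show "AE u in lborel. norm (E u) \<le> norm (exp (\<kappa> - \<kappa> * u\<^sup>2 + 0 * \<bar>u\<bar>))"
    proof (rule AE_I2)
      fix u :: real
      have "0 \<le> (u\<^sup>2 - 1/2)\<^sup>2" by simp
      also have "\<dots> = u^4 - u\<^sup>2 + 1/4" by (simp add: power2_diff field_simps)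
      finally have "\<kappa> * (u\<^sup>2 - 1) \<le> \<kappa> * u^4" using \<kappa> by (intro mult_left_mono) auto
      then show "norm (E u) \<le> norm (exp (\<kappa> - \<kappa> * u\<^sup>2 + 0 * \<bar>u\<bar>))"
        by (simp add: E_def algebra_simps)
    qed
  qed (simp add: E_def[abs_def])
  define f where "f t = t powr (1/4 - 1) / exp t" for t :: real
  define C where "C = 4 * \<kappa> powr (1/4)"
  have fg: "f (\<kappa> * u^4) * (4 * \<kappa> * u^3) = C * E u" if u: "u > 0" for u
  proof -
    have "(\<kappa> * u^4) powr (1/4 - 1) = \<kappa> powr (1/4 - 1) * (u^4) powr (1/4 - 1)"
      by (rule powr_mult)
    also have "(u^4) powr (1/4 - 1) = (u powr 4) powr (1/4 - 1)"
      using u by (simp only: powr_numeral)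
    also have "\<dots> = u powr (- 3)" by (simp add: powr_powr)
    also have "\<dots> = 1 / u^3" using u by (simp add: powr_minus_divide)
    also have "\<kappa> powr (1/4 - 1) = \<kappa> powr (1/4) / \<kappa>" using \<kappa> by (subst powr_diff) simp
    finally have "(\<kappa> * u^4) powr (1/4 - 1) = \<kappa> powr (1/4) / \<kappa> * (1 / u^3)" .
    then show ?thesis using u \<kappa> unfolding f_def E_def C_def by (simp add: exp_minus field_simps)
  qed
  have ein: "einterval 0 \<infinity> = {0::real<..}" by (auto simp: einterval_def)
  have setE: "set_integrable lborel {0<..} (\<lambda>u. C * E u)"
    unfolding set_integrable_def using intE by (intro integrable_mult_indicator integrable_mult_right) auto
  then have fgint: "set_integrable lborel (einterval 0 \<infinity>) (\<lambda>u. f (\<kappa> * u^4) * (4 * \<kappa> * u^3))"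
    unfolding ein by (subst set_integrable_cong[OF refl refl fg]) auto
  have A: "((ereal \<circ> (\<lambda>u. \<kappa> * u^4) \<circ> real_of_ereal) \<longlongrightarrow> 0) (at_right 0)"
  proof -
    have "((\<lambda>u. ereal (\<kappa> * u^4)) \<longlongrightarrow> ereal 0) (at_right 0)"
      by (rule tendsto_ereal) (auto intro!: tendsto_eq_intros)
    then show ?thesis
      unfolding zero_ereal_def by (intro iffD2[OF ereal_tendsto_simps(2)]) (simp add: o_def)
  qed
  have "LIM u at_top. \<kappa> * u^4 :> at_top"
    using \<kappa> by (intro filterlim_tendsto_pos_mult_at_top[OF tendsto_const] filterlim_pow_at_top filterlim_ident) auto
  then have B: "((ereal \<circ> (\<lambda>u. \<kappa> * u^4) \<circ> real_of_ereal) \<longlongrightarrow> \<infinity>) (at_left \<infinity>)"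
    by (simp add: ereal_tendsto_simps)
  have sub: "set_integrable lborel (einterval 0 \<infinity>) f"
     "(LBINT x=0..\<infinity>. f x) = (LBINT x=0..\<infinity>. f (\<kappa> * x^4) * (4 * \<kappa> * x^3))"
  proof -
    have 1: "DERIV (\<lambda>u. \<kappa> * u^4) x :> 4 * \<kappa> * x^3" for x
      by (auto intro!: derivative_eq_intros)
    have 2: "isCont f (\<kappa> * x^4)" if "0 < ereal x" for x
      using that \<kappa> unfolding f_def by (intro continuous_intros) auto
    have 3: "isCont (\<lambda>x. 4 * \<kappa> * x^3) x" for x by (intro continuous_intros)
    have 4: "0 \<le> f (\<kappa> * x^4)" for x unfolding f_def by simp
    have 5: "0 \<le> 4 * \<kappa> * x^3" if "0 \<le> ereal x" for x using that \<kappa> by simp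
    show "set_integrable lborel (einterval 0 \<infinity>) f"
      by (rule interval_integral_substitution_nonneg(1)[OF _ 1 2 3 4 5 A B fgint]) auto
    show "(LBINT x=0..\<infinity>. f x) = (LBINT x=0..\<infinity>. f (\<kappa> * x^4) * (4 * \<kappa> * x^3))"
      by (rule interval_integral_substitution_nonneg(2)[OF _ 1 2 3 4 5 A B fgint]) auto
  qed
  have "(f has_integral Gamma (1/4)) {0..}"
    using Gamma_integral_real[of "1/4"] unfolding f_def by simp
  then have "(f has_integral Gamma (1/4)) {0<..}"
  proof -
    assume "(f has_integral Gamma (1/4)) {0..}"
    \<comment> \<open>By the convention \<open>0 powr a = 0\<close> the integrand vanishes at 0, so
      closed and open half-line give the same integral.\<close>
    then have "((\<lambda>t. if t \<in> {0<..} then f t else 0) has_integral Gamma (1/4)) {0..}"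
      by (rule has_integral_eq[rotated]) (auto simp: f_def)
    then show ?thesis by (subst (asm) has_integral_restrict) auto
  qed
  then have "Gamma (1/4) = (LBINT x:{0<..}. f x)"
    using set_borel_integral_eq_integral(2)[OF sub(1)[unfolded ein]] by (simp add: integral_unique)
  also have "\<dots> = (LBINT x=0..\<infinity>. f x)" unfolding interval_lebesgue_integral_def ein by simp
  also note sub(2)
  also have "(LBINT x=0..\<infinity>. f (\<kappa> * x^4) * (4 * \<kappa> * x^3)) = (LBINT x:{0<..}. f (\<kappa> * x^4) * (4 * \<kappa> * x^3))"
    unfolding interval_lebesgue_integral_def ein by simp
  also have "\<dots> = (LBINT x:{0<..}. C * E x)"
    by (rule set_lebesgue_integral_cong) (auto simp: fg)
  also have "\<dots> = C * (LBINT x:{0<..}. E x)" by simp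
  finally have G: "(LBINT x:{0<..}. E x) = Gamma (1/4) / C" unfolding C_def using \<kappa> by simp
  have "has_bochner_integral lborel (\<lambda>x. indicator {0<..} x *\<^sub>R E x) (Gamma (1/4) / C)"
    unfolding has_bochner_integral_iff
    by (intro conjI integrable_mult_indicator intE) (use G in \<open>auto simp: set_lebesgue_integral_def\<close>)
  then have "has_bochner_integral lborel (\<lambda>x. indicator {0..} x *\<^sub>R E x) (Gamma (1/4) / C)"
    by (subst (asm) has_bochner_integral_discrete_difference[where X = "{0}" and g = "\<lambda>x. indicator {0..} x *\<^sub>R E x"])
       (auto simp: indicator_def)
  from has_bochner_integral_even_function[OF this] show ?thesis
    unfolding E_def C_def by simp
qed

text \<open>Since \<open>9/80 = (sqrt 3 / 2)^4 / 5\<close>, its fourth root is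
  \<open>sqrt 3 / (2 * root 4 5)\<close>; the reflection formula cancels the rest.\<close>

lemma quartic_normalization:
  "sqrt 3 * Gamma (3/4) / (sqrt 2 * pi * root 4 5) * (Gamma (1/4) / (2 * (9/80) powr (1/4))) = (1 :: real)"
proof -
  have r: "root 4 5 = 5 powr (1/4 :: real)" by (simp add: root_powr_inverse)
  have "(9/80 :: real) = (sqrt 3 / 2)^4 / 5"
    by (simp add: power_divide) (simp add: eval_nat_numeral)
  then have "(9/80 :: real) powr (1/4) = ((sqrt 3 / 2)^4 / 5) powr (1/4)" by (rule arg_cong)
  also have "\<dots> = ((sqrt 3 / 2)^4) powr (1/4) / 5 powr (1/4)"
    by (rule powr_divide)
  also have "((sqrt 3 / 2 :: real)^4) powr (1/4) = sqrt 3 / 2"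
  proof -
    have "((sqrt 3 / 2 :: real)^4) powr (1/4) = ((sqrt 3 / 2) powr 4) powr (1/4)"
      by (subst powr_numeral) simp_all
    also have "\<dots> = (sqrt 3 / 2) powr (4 * (1/4))" by (rule powr_powr)
    finally show ?thesis by simp
  qed
  finally have k: "(9/80 :: real) powr (1/4) = sqrt 3 / 2 / root 4 5" unfolding r .
  have "root 4 5 > (0::real)" by simp
  then have "sqrt 3 * Gamma (3/4) / (sqrt 2 * pi * root 4 5) * (Gamma (1/4) / (2 * (9/80) powr (1/4)))
     = (Gamma (1/4) * Gamma (3/4)) / (pi * sqrt 2)"
    unfolding k by (simp add: field_simps)
  also have "\<dots> = 1" unfolding Gamma_quarter_reflection by simp
  finally show ?thesis .
qed

lemma has_bochner_integral_quartic_density: "has_bochner_integral lborel quartic_density 1"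
proof -
  have "has_bochner_integral lborel (\<lambda>u. sqrt 3 * Gamma (3/4) / (sqrt 2 * pi * root 4 5) * exp (- (9/80 * u^4)))
     (sqrt 3 * Gamma (3/4) / (sqrt 2 * pi * root 4 5) * (Gamma (1/4) / (2 * (9/80) powr (1/4))))"
    by (intro has_bochner_integral_mult_right has_bochner_integral_exp_quartic) simp
  then show ?thesis unfolding quartic_normalization quartic_density_def[abs_def] by simp
qed

lemma quartic_density_nonneg: "quartic_density u \<ge> 0"
  unfolding quartic_density_def by (simp add: Gamma_real_pos less_imp_le)

lemma real_distribution_quartic: "real_distribution (density lborel quartic_density)"
proof -
  have "emeasure (density lborel quartic_density) (space (density lborel quartic_density)) = (\<integral>\<^sup>+ u. ennreal (quartic_density u) \<partial>lborel)"
    using has_bochner_integral_quartic_density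
    by (subst emeasure_density) (auto simp: has_bochner_integral_iff)
  also have "\<dots> = 1"
    using has_bochner_integral_quartic_density quartic_density_nonneg
    by (subst nn_integral_eq_integral) (auto simp: has_bochner_integral_iff)
  finally have "prob_space (density lborel quartic_density)" by (rule prob_spaceI)
  then show ?thesis unfolding real_distribution_def real_distribution_axioms_def by simp
qed

text \<open>Total mass 1 identifies the constant in the density with the reciprocal of the integral,
  which gives the quotient form in which the smoothed limit appears.\<close>

lemma char_quartic:
  "char (density lborel quartic_density) \<theta> = (CLBINT u. iexp (\<theta> * u) * complex_of_real (exp (- 9 * u^4 / 80)))
     / (CLBINT u. complex_of_real (exp (- 9 * u^4 / 80)))"
  and quartic_integral_nonzero: "(CLBINT u. complex_of_real (exp (- 9 * u^4 / 80))) \<noteq> 0"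
proof -
  define C where "C = sqrt 3 * Gamma (3/4) / (sqrt 2 * pi * root 4 5 :: real)"
  have q: "quartic_density = (\<lambda>u. C * exp (- 9 * u^4 / 80))"
    unfolding quartic_density_def[abs_def] C_def ..
  have [measurable]: "quartic_density \<in> borel_measurable borel" unfolding q by simp
  define X where "X = (\<integral>u. exp (- 9 * u^4 / 80 :: real) \<partial>lborel)"
  have "(\<integral>u. C * exp (- 9 * u^4 / 80) \<partial>lborel) = 1"
    using has_bochner_integral_quartic_density unfolding q by (simp only: has_bochner_integral_iff)
  then have I: "C * X = 1" unfolding X_def by (simp only: integral_mult_right_zero)
  have X: "(CLBINT u. complex_of_real (exp (- 9 * u^4 / 80))) = complex_of_real X"
    unfolding X_def by (rule integral_complex_of_real)
  show nz: "(CLBINT u. complex_of_real (exp (- 9 * u^4 / 80))) \<noteq> 0"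
    unfolding X using I by auto
  have I': "complex_of_real C * complex_of_real X = 1"
    using I by (simp only: of_real_mult[symmetric] of_real_1)
  have "char (density lborel quartic_density) \<theta> = (CLBINT u. quartic_density u *\<^sub>R iexp (\<theta> * u))"
    unfolding char_def using quartic_density_nonneg by (subst integral_density) auto
  also have "\<dots> = (CLBINT u. complex_of_real C * (iexp (\<theta> * u) * complex_of_real (exp (- 9 * u^4 / 80))))"
    unfolding q by (intro Bochner_Integration.integral_cong) (auto simp: scaleR_conv_of_real)
  also have "\<dots> = complex_of_real C * (CLBINT u. iexp (\<theta> * u) * complex_of_real (exp (- 9 * u^4 / 80)))"
    by (rule integral_mult_right_zero)
  also have "\<dots> = (CLBINT u. iexp (\<theta> * u) * complex_of_real (exp (- 9 * u^4 / 80)))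
     / (CLBINT u. complex_of_real (exp (- 9 * u^4 / 80)))"
  proof -
    have "complex_of_real C = 1 / complex_of_real X" using I' nz unfolding X by (simp add: field_simps)
    then show ?thesis unfolding X by simp
  qed
  finally show "char (density lborel quartic_density) \<theta> = (CLBINT u. iexp (\<theta> * u) * complex_of_real (exp (- 9 * u^4 / 80)))
     / (CLBINT u. complex_of_real (exp (- 9 * u^4 / 80)))" .
qed

lemma char_centred_normal:
  assumes \<sigma>: "\<sigma> > 0"
  shows "char (density lborel (normal_density 0 \<sigma>)) \<theta> = complex_of_real (exp (- (\<sigma>\<^sup>2 * \<theta>\<^sup>2 / 2)))"
proof -
  have A: "1 / \<sigma>\<^sup>2 > 0" using \<sigma> by simp
  have "char (density lborel (normal_density 0 \<sigma>)) \<theta> = (CLBINT u. normal_density 0 \<sigma> u *\<^sub>R iexp (\<theta> * u))"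
    unfolding char_def by (subst integral_density) auto
  also have "\<dots> = (CLBINT u. complex_of_real (1 / sqrt (2 * pi * \<sigma>\<^sup>2)) *
       (iexp (\<theta> * u) * complex_of_real (exp (- (1 / \<sigma>\<^sup>2 * (u - 0)\<^sup>2 / 2)))))"
    by (intro Bochner_Integration.integral_cong) (auto simp: normal_density_def scaleR_conv_of_real)
  also have "\<dots> = complex_of_real (1 / sqrt (2 * pi * \<sigma>\<^sup>2)) *
       (CLBINT u. iexp (\<theta> * u) * complex_of_real (exp (- (1 / \<sigma>\<^sup>2 * (u - 0)\<^sup>2 / 2))))"
    by (rule integral_mult_right_zero)
  also have "(CLBINT u. iexp (\<theta> * u) * complex_of_real (exp (- (1 / \<sigma>\<^sup>2 * (u - 0)\<^sup>2 / 2))))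
     = iexp (\<theta> * 0) * complex_of_real (sqrt (2 * pi / (1 / \<sigma>\<^sup>2)) * exp (- (\<theta>\<^sup>2 / (2 * (1 / \<sigma>\<^sup>2)))))"
    by (rule has_bochner_integral_integral_eq[OF has_bochner_integral_gaussian_iexp[OF A]])
  finally show ?thesis using \<sigma> by (simp add: real_sqrt_mult mult.commute)
qed

text \<open>Some admissible exponent lies below \<open>t\<close>. It may be increased because
  \<open>\<bar>h\<bar> \<ge> 1\<close> for nonzero integers; the midpoint of 1 and \<open>t\<close>
  raises it above 1, as the discrepancy bound requires.\<close>

lemma irrational_type_less:
  fixes t :: real
  assumes "irrational_type \<alpha> < ereal t" "t > 1"
  obtains s c where "1 < s" "s < t" "c > 0"
    "\<And>h::int. h \<noteq> 0 \<Longrightarrow> \<bar>of_int h\<bar> powr s * dist_nearest_int (of_int h * \<alpha>) \<ge> c"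
proof -
  obtain \<sigma> c where \<sigma>: "\<sigma> < t" and c: "c > 0"
    "\<And>h::int. h \<noteq> 0 \<Longrightarrow> \<bar>of_int h\<bar> powr \<sigma> * dist_nearest_int (of_int h * \<alpha>) \<ge> c"
    using assms(1) unfolding irrational_type_def Inf_less_iff by auto
  define s where "s = max \<sigma> ((1 + t) / 2)"
  have "\<bar>of_int h\<bar> powr s * dist_nearest_int (of_int h * \<alpha>) \<ge> c" if "h \<noteq> 0" for h :: int
  proof -
    have "\<bar>of_int h :: real\<bar> \<ge> 1" using that by linarith
    then have "\<bar>of_int h\<bar> powr \<sigma> * dist_nearest_int (of_int h * \<alpha>) \<le> \<bar>of_int h\<bar> powr s * dist_nearest_int (of_int h * \<alpha>)"
      unfolding s_def by (intro mult_right_mono powr_mono) (auto simp: dist_nearest_int_def)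
    with c(2)[OF that] show ?thesis by linarith
  qed
  moreover have "1 < s" "s < t" using \<sigma> assms(2) unfolding s_def by (auto simp: less_max_iff_disj)
  ultimately show ?thesis using that c(1) by blast
qed

section \<open>Limit laws below and at the critical temperature\<close>

context equidistributed_rotation_gibbs
begin

text \<open>With \<open>\<gamma> = 1/2\<close> the auxiliary Gaussian keeps the variance
  \<open>1/b\<close>, while the smoothed limit has variance \<open>1/A\<close>; the difference
  \<open>1/A - 1/b = 2 / (3 - 2 b)\<close> is the variance of the magnetization.\<close>

lemma weak_conv_subcritical:
  assumes b: "\<beta> * J < 3 / 2" and \<delta>: "\<delta> < 1 / 2"
  shows "weak_conv_m (\<lambda>n. distr (gibbs_measure f \<alpha> J \<beta> n x) borel (\<lambda>\<sigma>. magnetization n \<sigma> / real n)) (return borel 0)"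
    and "weak_conv_m (\<lambda>n. distr (gibbs_measure f \<alpha> J \<beta> n x) borel (\<lambda>\<sigma>. magnetization n \<sigma> / sqrt (real n)))
      (density lborel (normal_density 0 (sqrt (2 / (3 - 2 * \<beta> * J)))))"
proof -
  define b where "b = \<beta> * J"
  define A where "A = b - 2 * b\<^sup>2 / 3"
  define s where "s = sqrt (2 / (3 - 2 * \<beta> * J))"
  let ?L = "\<lambda>u. - (A * u\<^sup>2 / 2)"
  have b: "b > 0" "b < 3 / 2" unfolding b_def using assms(1) rotation_gibbs_axioms by (auto simp: rotation_gibbs_def)
  have "A = b * (1 - 2 * b / 3)" unfolding A_def by (simp add: power2_eq_square algebra_simps)
  with b have A: "A > 0" by simp
  have s: "s > 0" "s\<^sup>2 = 2 / (3 - 2 * b)" unfolding s_def b_def using b unfolding b_def by (auto simp: mult.assoc)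
  have gauss: "(CLBINT u. iexp (\<theta> * u) * complex_of_real (exp (?L u)))
      = complex_of_real (sqrt (2 * pi / A) * exp (- (\<theta>\<^sup>2 / (2 * A))))" for \<theta>
    using has_bochner_integral_integral_eq[OF has_bochner_integral_gaussian_iexp[OF A, of \<theta> 0]] by simp
  have gauss0: "(CLBINT u. complex_of_real (exp (?L u))) = complex_of_real (sqrt (2 * pi / A))"
    using gauss[of 0] by simp
  have dist: "real_distribution (density lborel (normal_density 0 s))"
    using prob_space_normal_density[OF s(1)] by (simp add: real_distribution_def real_distribution_axioms_def)
  have \<kappa>: "(\<lambda>n. real n powr (2 * (1/2) - 1) / (2 * (\<beta> * J))) \<longlonglongrightarrow> 1 / (2 * b)"
  proof -
    have "\<forall>\<^sub>F n in sequentially. real n powr (2 * (1/2) - 1) / (2 * (\<beta> * J)) = 1 / (2 * b)"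
      by (rule eventually_sequentially_pos) (simp add: b_def)
    then show ?thesis by (rule tendsto_eventually)
  qed
  have char: "char (density lborel (normal_density 0 s)) \<theta> = (CLBINT u. iexp (\<theta> * u) * complex_of_real (exp (?L u)))
        / (CLBINT u. complex_of_real (exp (?L u))) * complex_of_real (exp (\<theta>\<^sup>2 * (1 / (2 * b))))" for \<theta>
  proof -
    have "3 - 2 * b > 0" using b by simp
    then have "1 / A - 1 / b = s\<^sup>2"
      unfolding A_def s(2) using b A[unfolded A_def] by (simp add: divide_simps) (simp add: power2_eq_square algebra_simps)
    then have "- (s\<^sup>2 * \<theta>\<^sup>2 / 2) = - (\<theta>\<^sup>2 / (2 * A)) + \<theta>\<^sup>2 * (1 / (2 * b))"
      by (auto simp: field_simps simp flip: \<open>1 / A - 1 / b = s\<^sup>2\<close>)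
    then have "exp (- (s\<^sup>2 * \<theta>\<^sup>2 / 2)) = exp (- (\<theta>\<^sup>2 / (2 * A))) * exp (\<theta>\<^sup>2 * (1 / (2 * b)))"
      by (simp only: exp_add)
    then show ?thesis
      unfolding char_centred_normal[OF s(1)] gauss gauss0 using A by simp
  qed
  have nz: "(CLBINT u. complex_of_real (exp (?L u))) \<noteq> 0" unfolding gauss0 using A by simp
  have bound: "real n * (mean_log_mgf (\<beta> * J * u * real n powr (- (1/2))) - (\<beta> * J * u * real n powr (- (1/2)))\<^sup>2 / (2 * (\<beta> * J)))
      \<le> 0 - A / 2 * u\<^sup>2" if "n > 0" for n u
    using free_energy_limit_subcritical(2)[OF b(1) that, of u] unfolding A_def b_def by simp
  note W = weak_conv_scaled_magnetization[OF _ \<delta> _ free_energy_limit_subcritical(1)[OF b(1), folded A_def, unfolded b_def]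
      bound \<kappa> nz dist char]
  show "weak_conv_m (\<lambda>n. distr (gibbs_measure f \<alpha> J \<beta> n x) borel (\<lambda>\<sigma>. magnetization n \<sigma> / real n)) (return borel 0)"
    by (rule W(1)) (use A in auto)
  have "weak_conv_m (\<lambda>n. distr (gibbs_measure f \<alpha> J \<beta> n x) borel (\<lambda>\<sigma>. magnetization n \<sigma> / real n powr (1 - 1/2)))
      (density lborel (normal_density 0 s))"
    by (rule W(2)) (use A in auto)
  then show "weak_conv_m (\<lambda>n. distr (gibbs_measure f \<alpha> J \<beta> n x) borel (\<lambda>\<sigma>. magnetization n \<sigma> / sqrt (real n)))
      (density lborel (normal_density 0 (sqrt (2 / (3 - 2 * \<beta> * J)))))"
    unfolding s_def by (simp add: powr_half_sqrt)
qed

text \<open>With \<open>\<gamma> = 1/4\<close> the auxiliary variance is of order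
  \<open>n powr (-1/2)\<close> and disappears, so the smoothed limit is already the law of the
  magnetization.\<close>

lemma weak_conv_critical:
  assumes b: "\<beta> * J = 3 / 2" and \<delta>: "\<delta> < 1 / 4"
  shows "weak_conv_m (\<lambda>n. distr (gibbs_measure f \<alpha> J \<beta> n x) borel (\<lambda>\<sigma>. magnetization n \<sigma> / real n)) (return borel 0)"
    and "weak_conv_m (\<lambda>n. distr (gibbs_measure f \<alpha> J \<beta> n x) borel (\<lambda>\<sigma>. magnetization n \<sigma> / real n powr (3/4)))
      (density lborel quartic_density)"
proof -
  have \<kappa>: "(\<lambda>n. real n powr (2 * (1/4) - 1) / (2 * (\<beta> * J))) \<longlonglongrightarrow> 0"
  proof -
    have "(\<lambda>n. real n powr (- (1/2))) \<longlonglongrightarrow> 0"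
      by (intro tendsto_neg_powr filterlim_real_sequentially) simp
    from tendsto_mult_left_zero[OF this, of "1 / (2 * (\<beta> * J))"] show ?thesis by simp
  qed
  have char: "char (density lborel quartic_density) \<theta> = (CLBINT u. iexp (\<theta> * u) * complex_of_real (exp (- 9 * u^4 / 80)))
     / (CLBINT u. complex_of_real (exp (- 9 * u^4 / 80))) * complex_of_real (exp (\<theta>\<^sup>2 * 0))" for \<theta>
    using char_quartic by simp
  note W = weak_conv_scaled_magnetization[of "1/4" "9/40", OF _ \<delta> _
      free_energy_limit_critical(1)[folded b] free_energy_limit_critical(2)[folded b] \<kappa>
      quartic_integral_nonzero real_distribution_quartic char]
  show "weak_conv_m (\<lambda>n. distr (gibbs_measure f \<alpha> J \<beta> n x) borel (\<lambda>\<sigma>. magnetization n \<sigma> / real n)) (return borel 0)"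
    by (rule W(1)) auto
  have "weak_conv_m (\<lambda>n. distr (gibbs_measure f \<alpha> J \<beta> n x) borel (\<lambda>\<sigma>. magnetization n \<sigma> / real n powr (1 - 1/4)))
      (density lborel quartic_density)"
    by (rule W(2)) auto
  then show "weak_conv_m (\<lambda>n. distr (gibbs_measure f \<alpha> J \<beta> n x) borel (\<lambda>\<sigma>. magnetization n \<sigma> / real n powr (3/4)))
      (density lborel quartic_density)" by simp
qed

end

text \<open>An admissible exponent \<open>s < t\<close> yields \<open>\<delta> = 1 - 1/s\<close>,
  strictly below \<open>1 - 1/t\<close>. The thresholds \<open>t = 2\<close> and
  \<open>t = 4/3\<close> turn this into the required \<open>1/2\<close> and
  \<open>1/4\<close>.\<close>

lemma equidistributed_rotation_gibbs_exists:
  fixes t :: real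
  assumes "irrational_type \<alpha> < ereal t" "t > 1"
    and f: "\<And>y. y \<in> {0..<1} \<Longrightarrow> f y = y" and x: "x \<in> {0..<1}" and b: "\<beta> * J > 0"
  shows "\<exists>K \<delta>. \<delta> < 1 - 1/t \<and> equidistributed_rotation_gibbs f \<alpha> x J \<beta> K \<delta>"
proof -
  obtain s c where s: "1 < s" "s < t" and c: "c > 0"
      "\<And>h::int. h \<noteq> 0 \<Longrightarrow> \<bar>of_int h\<bar> powr s * dist_nearest_int (of_int h * \<alpha>) \<ge> c"
    using irrational_type_less[OF assms(1,2)] by blast
  obtain K where K: "K \<ge> 0" "\<And>(g::real \<Rightarrow> real) y n. mono_on {0..1} g \<Longrightarrow> g integrable_on {0..1} \<Longrightarrow>
       \<bar>(\<Sum>i<n. g (frac (y + real i * \<alpha>))) - real n * integral {0..1} g\<bar>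
         \<le> K * (g 1 - g 0) * real n powr (1 - 1/s)"
    using orbit_sum_discrepancy[OF c(1) s(1) c(2)] by blast
  have orbit: "f ((rotation \<alpha> ^^ i) x) = frac (x + real i * \<alpha>)" for i
    unfolding rotation_funpow[OF x] by (rule f) (auto simp: frac_lt_1)
  have "equidistributed_rotation_gibbs f \<alpha> x J \<beta> K (1 - 1/s)"
  proof unfold_locales
    show "0 \<le> f ((rotation \<alpha> ^^ i) x)" "f ((rotation \<alpha> ^^ i) x) \<le> 1" for i
      unfolding orbit by (auto simp: less_imp_le[OF frac_lt_1])
  qed (use b orbit K in auto)
  moreover have "1 - 1/s < 1 - 1/t" using s by (simp add: field_simps)
  ultimately show ?thesis by blast
qed

theorem theorem5p2:
  fixes \<alpha> x J :: real and \<eta> :: ereal and f :: "real \<Rightarrow> real"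
  assumes "\<alpha> \<notin> \<rat>"
    and "irrational_type \<alpha> = \<eta>"
    and "\<And>y. y \<in> {0..<1} \<Longrightarrow> f y = y"
    and "J > 0"
    and "x \<in> {0..<1}"
  shows "critical_beta J = 3 / (2 * J) \<and>
    (\<forall>\<beta>. 0 < \<beta> \<and> \<beta> < critical_beta J \<and> \<eta> < 2 \<longrightarrow>
       weak_conv_m
         (\<lambda>n. distr (gibbs_measure f \<alpha> J \<beta> n x) borel (\<lambda>\<sigma>. magnetization n \<sigma> / real n))
         (return borel 0) \<and>
       weak_conv_m
         (\<lambda>n. distr (gibbs_measure f \<alpha> J \<beta> n x) borel (\<lambda>\<sigma>. magnetization n \<sigma> / sqrt (real n)))
         (density lborel (normal_density 0 (sqrt (2 / (3 - 2 * \<beta> * J)))))) \<and>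
    (\<forall>\<beta>. \<beta> = critical_beta J \<and> \<eta> < ereal (4 / 3) \<longrightarrow>
       weak_conv_m
         (\<lambda>n. distr (gibbs_measure f \<alpha> J \<beta> n x) borel (\<lambda>\<sigma>. magnetization n \<sigma> / real n))
         (return borel 0) \<and>
       weak_conv_m
         (\<lambda>n. distr (gibbs_measure f \<alpha> J \<beta> n x) borel (\<lambda>\<sigma>. magnetization n \<sigma> / real n powr (3 / 4)))
         (density lborel quartic_density))"
proof (intro conjI allI impI; (elim conjE)?)
  show crit: "critical_beta J = 3 / (2 * J)" by (rule critical_beta_eq[OF assms(4)])
  {
    fix \<beta> assume \<beta>: "0 < \<beta>" "\<beta> < critical_beta J" and "\<eta> < 2"
    then have "irrational_type \<alpha> < ereal 2" "\<beta> * J > 0" using assms(2,4) by auto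
    from equidistributed_rotation_gibbs_exists[OF this(1) _ assms(3,5) this(2)]
    obtain K \<delta> where \<delta>: "\<delta> < 1 - 1/2" and "equidistributed_rotation_gibbs f \<alpha> x J \<beta> K \<delta>" by auto
    then interpret equidistributed_rotation_gibbs f \<alpha> x J \<beta> K \<delta> by simp
    have "\<beta> * J < 3 / 2" using \<beta> assms(4) unfolding crit by (simp add: field_simps)
    from weak_conv_subcritical[OF this] \<delta>
    show "weak_conv_m (\<lambda>n. distr (gibbs_measure f \<alpha> J \<beta> n x) borel (\<lambda>\<sigma>. magnetization n \<sigma> / real n)) (return borel 0)"
      and "weak_conv_m (\<lambda>n. distr (gibbs_measure f \<alpha> J \<beta> n x) borel (\<lambda>\<sigma>. magnetization n \<sigma> / sqrt (real n)))
         (density lborel (normal_density 0 (sqrt (2 / (3 - 2 * \<beta> * J)))))"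
      by simp_all
  }
  {
    fix \<beta> assume \<beta>: "\<beta> = critical_beta J" and "\<eta> < ereal (4 / 3)"
    then have type: "irrational_type \<alpha> < ereal (4 / 3)" using assms(2) by simp
    have bJ: "\<beta> * J = 3 / 2" using \<beta> assms(4) unfolding crit by simp
    then have "\<beta> * J > 0" by simp
    from equidistributed_rotation_gibbs_exists[OF type _ assms(3,5) this]
    obtain K \<delta> where \<delta>: "\<delta> < 1 - 1/(4/3)" and "equidistributed_rotation_gibbs f \<alpha> x J \<beta> K \<delta>" by auto
    then interpret equidistributed_rotation_gibbs f \<alpha> x J \<beta> K \<delta> by simp
    from weak_conv_critical[OF bJ] \<delta>
    show "weak_conv_m (\<lambda>n. distr (gibbs_measure f \<alpha> J \<beta> n x) borel (\<lambda>\<sigma>. magnetization n \<sigma> / real n)) (return borel 0)"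
      and "weak_conv_m (\<lambda>n. distr (gibbs_measure f \<alpha> J \<beta> n x) borel (\<lambda>\<sigma>. magnetization n \<sigma> / real n powr (3 / 4)))
         (density lborel quartic_density)"
      by simp_all
  }
qed

end
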